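(* Let $\mathcal{T}\subset\mathbb{N}^n$ be $\mathcal{S}_n$-invariant, let $\mathcal{T}^+=\mathcal{T}\cap(2\mathbb{N})^n$, and let $\widehat{\mathcal{T}}$ be a set of orbit representatives of $\mathcal{T}$. Assume that for every $\beta\in\widehat{\mathcal{T}}\setminus\mathcal{T}^+$ we have $\beta\in\operatorname{conv}(\mathcal{T}^+\cup\{0\})$. Then: (1) The sequence of cones $C^{m,k}_{\mathrm{SONC}}(\mathcal{T})$, $k\ge n$, is increasing and full-dimensional, so that the cone $C^{m,\infty}_{\mathrm{SONC}}(\mathcal{T})$ is also full-dimensional. (2) The cone $C^{M,\infty}_{\mathrm{SONC}}(\mathcal{T})$ can be of strictly lower dimension than the cone $C^{M,\infty}_{\ge 0}(\mathcal{T})$.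
   Context: The symmetric group $\mathcal{S}_k$ acts on $\mathbb{N}^k$ by permuting coordinates, $0\in\mathbb{N}$, and $\mathcal{T}$ is a nonempty finite support set. For $\alpha\in\mathbb{N}^k$ let $M_\alpha^{(k)}=\sum_{\beta\in\mathcal{S}_k\cdot\alpha}x_1^{\beta_1}\cdots x_k^{\beta_k}$ (monomial symmetric polynomial) and $m_\alpha^{(k)}=M_\alpha^{(k)}/M_\alpha^{(k)}(1,\ldots,1)$ (monomial mean). For $\lambda\in\mathbb{N}^n$ and $k\ge n$, $M_\lambda^{(k)}$ and $m_\lambda^{(k)}$ are defined by extending $\lambda$ with zeros to a vector in $\mathbb{N}^k$. For a finite support set $\mathcal{U}\subset\mathbb{N}^k$, the SONC polynomials supported on $\mathcal{U}$ are the finite sums of AG polynomials supported on $\mathcal{U}$, i.e. of polynomials that are nonnegative on $\mathbb{R}^k$ and of the form $\sum_{\alpha\in\mathcal{U}\setminus\{\beta\}}c_\alpha x^\alpha+c_\beta x^\beta$ with $\beta\in\mathcal{U}$, $c_\beta\in\mathbb{R}$, $c_\alpha\ge 0$ for all $\alpha\in\mathcal{U}\setminus\{\beta\}$, and $c_\alpha=0$ for all $\alpha\in\mathcal{U}\setminus\{\beta\}$ with $\alpha\notin(2\mathbb{N})^k$. Below, in $k$ variables, the support set is the $\mathcal{S}_k$-invariant set generated by the elements of $\mathcal{T}$ extended with zeros. For $k\ge n$, the space $V^k(\mathcal{T})=\operatorname{span}\{M_\lambda^{(k)}:\lambda\in\widehat{\mathcal{T}}\}=\operatorname{span}\{m_\lambda^{(k)}:\lambda\in\widehat{\mathcal{T}}\}$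 is identified with $\mathbb{R}^{|\widehat{\mathcal{T}}|}$ via coefficients, in two ways: with respect to the basis $(M_\lambda^{(k)})$ (non-normalized setup, superscript $M$) or with respect to the basis $(m_\lambda^{(k)})$ (normalized setup, superscript $m$). Thus - $C^{M,k}_{\ge 0}(\mathcal{T})$ (resp. $C^{M,k}_{\mathrm{SONC}}(\mathcal{T})$) is the set of $(c_\lambda)\in\mathbb{R}^{|\widehat{\mathcal{T}}|}$ such that $\sum_{\lambda\in\widehat{\mathcal{T}}}c_\lambda M_\lambda^{(k)}$ is nonnegative on $\mathbb{R}^k$ (resp. is SONC); - $C^{m,k}_{\ge 0}(\mathcal{T})$ and $C^{m,k}_{\mathrm{SONC}}(\mathcal{T})$ are defined in the same way with $m_\lambda^{(k)}$ in place of $M_\lambda^{(k)}$; - the limit cones are $C^{M,\infty}_{\bullet}(\mathcal{T})=\bigcap_{k\ge n}C^{M,k}_{\bullet}(\mathcal{T})$ and $C^{m,\infty}_{\bullet}(\mathcal{T})=\bigcap_{k\ge n}C^{m,k}_{\bullet}(\mathcal{T})$, for $\bullet\in\{\ge 0,\mathrm{SONC}\}$. Increasing means $C^{m,k}_{\mathrm{SONC}}(\mathcal{T})\subseteq C^{m,k+1}_{\mathrm{SONC}}(\mathcal{T})$ for all $k\ge n$; the dimension of a cone is the dimension of its linear span, and full-dimensional means of dimension $|\widehat{\mathcal{T}}|$.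
   Formalization: Full-dimensionality in (1) is proved under an added condition: if 0 is not in T, every β in T-hat \ T^+ must lie in conv(T^+), not just conv(T^+ ∪ {0}). Without it the claim fails, e.g. n=1, T={1,2}: c1 x + c2 x^2 ≥ 0 forces c1=0. *)

theory Defs
  imports "HOL-Analysis.Analysis" "HOL-Analysis.Finite_Function_Topology"
begin

text \<open>
  An exponent vector in \<open>\<nat>\<^sup>k\<close> is a finitely supported map \<open>nat \<Rightarrow>\<^sub>0 nat\<close> whose support lies in
  \<open>{..<k}\<close>, so that \<open>\<nat>\<^sup>n\<close> is contained in \<open>\<nat>\<^sup>k\<close> for \<open>n \<le> k\<close> and the extension of a vector by zeros
  is the vector itself.  In the same way, points of \<open>\<real>\<^sup>k\<close> are real sequences vanishing from
  index \<open>k\<close> on.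
\<close>

type_synonym expo = "nat \<Rightarrow>\<^sub>0 nat"
type_synonym rpoly = "expo \<Rightarrow>\<^sub>0 real"

definition expos :: "nat \<Rightarrow> expo set" where
  "expos k = {\<alpha>. Poly_Mapping.keys \<alpha> \<subseteq> {..<k}}"

definition points :: "nat \<Rightarrow> (nat \<Rightarrow> real) set" where
  "points k = {x. \<forall>i\<ge>k. x i = 0}"

definition even_expos :: "expo set" where
  "even_expos = {\<alpha>. \<forall>i. even (Poly_Mapping.lookup \<alpha> i)}"

definition real_vec :: "expo \<Rightarrow> (nat \<Rightarrow>\<^sub>0 real)" where
  "real_vec \<alpha> = Poly_Mapping.map real \<alpha>"

definition poly_eval :: "(nat \<Rightarrow> real) \<Rightarrow> rpoly \<Rightarrow> real" where
  "poly_eval x f = (\<Sum>\<alpha>\<in>Poly_Mapping.keys f. Poly_Mapping.lookup f \<alpha> *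
     (\<Prod>i\<in>Poly_Mapping.keys \<alpha>. x i ^ Poly_Mapping.lookup \<alpha> i))"

definition nonneg_poly :: "nat \<Rightarrow> rpoly \<Rightarrow> bool" where
  "nonneg_poly k f \<longleftrightarrow> (\<forall>x\<in>points k. 0 \<le> poly_eval x f)"

definition orbit :: "nat \<Rightarrow> expo \<Rightarrow> expo set" where
  "orbit k \<alpha> = {\<beta>. \<exists>\<pi>. \<pi> permutes {..<k} \<and>
     Poly_Mapping.lookup \<beta> = Poly_Mapping.lookup \<alpha> \<circ> \<pi>}"

definition sym_invariant :: "nat \<Rightarrow> expo set \<Rightarrow> bool" where
  "sym_invariant n T \<longleftrightarrow> (\<forall>\<alpha>\<in>T. orbit n \<alpha> \<subseteq> T)"

definition orbit_reps :: "nat \<Rightarrow> expo set \<Rightarrow> expo set \<Rightarrow> bool" where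
  "orbit_reps n T R \<longleftrightarrow> R \<subseteq> T \<and> (\<forall>\<alpha>\<in>T. \<exists>!\<rho>. \<rho> \<in> R \<and> \<rho> \<in> orbit n \<alpha>)"

definition monom_sym :: "nat \<Rightarrow> expo \<Rightarrow> rpoly" where
  "monom_sym k \<alpha> = (\<Sum>\<beta>\<in>orbit k \<alpha>. Poly_Mapping.single \<beta> 1)"

text \<open>The indicator function is the point \<open>(1, \<dots>, 1)\<close> of \<open>\<real>\<^sup>k\<close>.\<close>

definition monom_mean :: "nat \<Rightarrow> expo \<Rightarrow> rpoly" where
  "monom_mean k \<alpha> = monom_sym k \<alpha> /\<^sub>R poly_eval (indicator {..<k}) (monom_sym k \<alpha>)"

definition ag_poly :: "nat \<Rightarrow> expo set \<Rightarrow> rpoly \<Rightarrow> bool" where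
  "ag_poly k U f \<longleftrightarrow> nonneg_poly k f \<and>
     (\<exists>\<beta>\<in>U. \<exists>c :: expo \<Rightarrow> real.
        f = (\<Sum>\<alpha>\<in>U - {\<beta>}. Poly_Mapping.single \<alpha> (c \<alpha>)) + Poly_Mapping.single \<beta> (c \<beta>) \<and>
        (\<forall>\<alpha>\<in>U - {\<beta>}. 0 \<le> c \<alpha>) \<and>
        (\<forall>\<alpha>\<in>U - {\<beta>}. \<alpha> \<notin> even_expos \<longrightarrow> c \<alpha> = 0))"

definition sonc_poly :: "nat \<Rightarrow> expo set \<Rightarrow> rpoly \<Rightarrow> bool" where
  "sonc_poly k U f \<longleftrightarrow> (\<exists>gs. (\<forall>g\<in>set gs. ag_poly k U g) \<and> f = sum_list gs)"

definition sym_support :: "nat \<Rightarrow> expo set \<Rightarrow> expo set" where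
  "sym_support k T = (\<Union>\<alpha>\<in>T. orbit k \<alpha>)"

text \<open>
  For a set \<open>R\<close> of orbit representatives, a coefficient vector in \<open>\<real>\<^bsup>|R|\<^esup>\<close> is a map
  \<open>expo \<Rightarrow>\<^sub>0 real\<close> supported on \<open>R\<close>; it is not to be confused with the polynomial it encodes,
  which happens to have the same type.  The family \<open>B\<close> is \<open>monom_sym\<close> in the non-normalized
  setup and \<open>monom_mean\<close> in the normalized setup.
\<close>

definition sym_poly ::
    "(nat \<Rightarrow> expo \<Rightarrow> rpoly) \<Rightarrow> nat \<Rightarrow> expo set \<Rightarrow> (expo \<Rightarrow>\<^sub>0 real) \<Rightarrow> rpoly" where
  "sym_poly B k R c = (\<Sum>\<rho>\<in>R. Poly_Mapping.lookup c \<rho> *\<^sub>R B k \<rho>)"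

definition cone_nonneg ::
    "(nat \<Rightarrow> expo \<Rightarrow> rpoly) \<Rightarrow> nat \<Rightarrow> expo set \<Rightarrow> (expo \<Rightarrow>\<^sub>0 real) set" where
  "cone_nonneg B k R = {c. Poly_Mapping.keys c \<subseteq> R \<and> nonneg_poly k (sym_poly B k R c)}"

definition cone_sonc ::
    "(nat \<Rightarrow> expo \<Rightarrow> rpoly) \<Rightarrow> nat \<Rightarrow> expo set \<Rightarrow> expo set \<Rightarrow> (expo \<Rightarrow>\<^sub>0 real) set" where
  "cone_sonc B k T R =
     {c. Poly_Mapping.keys c \<subseteq> R \<and> sonc_poly k (sym_support k T) (sym_poly B k R c)}"

definition limit_cone_nonneg ::
    "(nat \<Rightarrow> expo \<Rightarrow> rpoly) \<Rightarrow> nat \<Rightarrow> expo set \<Rightarrow> (expo \<Rightarrow>\<^sub>0 real) set" where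
  "limit_cone_nonneg B n R = (\<Inter>k\<in>{n..}. cone_nonneg B k R)"

definition limit_cone_sonc ::
    "(nat \<Rightarrow> expo \<Rightarrow> rpoly) \<Rightarrow> nat \<Rightarrow> expo set \<Rightarrow> expo set \<Rightarrow> (expo \<Rightarrow>\<^sub>0 real) set" where
  "limit_cone_sonc B n T R = (\<Inter>k\<in>{n..}. cone_sonc B k T R)"

definition cone_dim :: "(expo \<Rightarrow>\<^sub>0 real) set \<Rightarrow> nat" where
  "cone_dim C = dim (span C)"

definition admissible :: "nat \<Rightarrow> expo set \<Rightarrow> expo set \<Rightarrow> bool" where
  "admissible n T R \<longleftrightarrow>
     finite T \<and> T \<noteq> {} \<and> T \<subseteq> expos n \<and> sym_invariant n T \<and> orbit_reps n T R \<and>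
     (\<forall>\<beta>\<in>R - even_expos. real_vec \<beta> \<in> convex hull (real_vec ` ((T \<inter> even_expos) \<union> {0})))"

text \<open>
  If \<open>0 \<in> T\<close>, the following condition is void.  If \<open>0 \<notin> T\<close>, the constant monomial is not
  available in SONC polynomials supported on \<open>T\<close>, and \<open>admissible\<close> alone does not give full
  dimension: for \<open>n = 1\<close> and \<open>T = {1, 2}\<close>, nonnegativity of \<open>c\<^sub>1 x + c\<^sub>2 x\<^sup>2\<close> forces \<open>c\<^sub>1 = 0\<close>,
  although \<open>1 \<in> conv {2, 0}\<close>.  The condition also follows from \<open>admissible\<close> when all elements of
  \<open>T\<close> have the same positive degree.
\<close>

definition origin_compatible :: "expo set \<Rightarrow> expo set \<Rightarrow> bool" where
  "origin_compatible T R \<longleftrightarrow>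
     (0 \<notin> T \<longrightarrow> (\<forall>\<beta>\<in>R - even_expos. real_vec \<beta> \<in> convex hull (real_vec ` (T \<inter> even_expos))))"

end

theory Submission
  imports Defs
begin

text \<open>
  The monomial mean is the symmetrization of a single monomial: averaging \<open>x\<^sup>\<alpha>\<close> over all
  permutations of \<open>l\<close> variables gives \<open>m\<^sub>\<alpha>\<close> in \<open>l\<close> variables, and averaging \<open>m\<^sub>\<alpha>\<close> in \<open>k \<le> l\<close>
  variables gives the same result, since it is a mean of monomials from one orbit
  (\<open>sym_avg_monom_mean\<close>).  An AG polynomial stays an AG polynomial when variables are added,
  when variables are permuted and when it is multiplied by a nonnegative number, so
  symmetrization preserves SONC polynomials (\<open>sonc_poly_sym_avg\<close>).  Hence a coefficient vector that
  is SONC with respect to the means in \<open>k\<close> variables is SONC in \<open>l\<close> variables as well, and the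
  limit cone is the cone at the first level \<open>n\<close>.

  For full dimension it therefore suffices to span all unit vectors at level \<open>n\<close>.  A unit vector
  at an even exponent lies in the cone itself.  For an odd exponent \<open>\<beta>\<close>, the hypotheses put \<open>\<beta>\<close>
  into the convex hull of the even exponents of \<open>T\<close>, so \<open>\<bar>x\<^sup>\<beta>\<bar>\<close> is at most the sum of the even
  monomials, and that sum plus \<open>x\<^sup>\<beta>\<close> is an AG polynomial (\<open>ag_poly_hull\<close>).  Its
  symmetrization is the unit vector at \<open>\<beta>\<close> plus vectors that are already in the cone.

  In the non-normalized setup the dimension can drop.  Take the orbits of \<open>x\<^sub>0\<^sup>2\<close> and \<open>x\<^sub>0 x\<^sub>1\<close> and
  a form \<open>p \<Sum> x\<^sub>i\<^sup>2 + q \<Sum> x\<^sub>i x\<^sub>j\<close>, the second sum being over pairs.  The squares available to the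
  AG summands grow only linearly in the number \<open>k\<close> of variables, while there are quadratically
  many mixed terms, each of which must be compensated by squares.  This gives
  \<open>\<bar>q\<bar> (k - 1) \<le> 2 p\<close> for all \<open>k\<close>, so that \<open>q = 0\<close> in the limit.  But \<open>p = 1\<close>, \<open>q = 2\<close> is the square
  of \<open>\<Sum> x\<^sub>i\<close>, so the limit cone of nonnegative forms has dimension two.
\<close>

section \<open>Linear functionals on finitely supported maps\<close>

lemma lookup_scaleR: "Poly_Mapping.lookup (r *\<^sub>R f) a = r *\<^sub>R Poly_Mapping.lookup f a"
proof -
  have "finite {i. r *\<^sub>R Poly_Mapping.lookup f i \<noteq> 0}"
    by (rule finite_subset[OF _ finite_keys[of f]]) (auto simp: in_keys_iff)
  then show ?thesis
    by (simp add: scaleR_poly_mapping_def)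
qed

lemma scaleR_single: "r *\<^sub>R Poly_Mapping.single a c = Poly_Mapping.single a (r *\<^sub>R c)"
  by (rule poly_mapping_eqI) (simp add: lookup_scaleR lookup_single when_def)

lemma poly_mapping_sum_singles:
  assumes "finite S" "Poly_Mapping.keys f \<subseteq> S"
  shows "f = (\<Sum>a\<in>S. Poly_Mapping.single a (Poly_Mapping.lookup f a))"
proof (rule poly_mapping_eqI)
  fix b
  show "Poly_Mapping.lookup f b
      = Poly_Mapping.lookup (\<Sum>a\<in>S. Poly_Mapping.single a (Poly_Mapping.lookup f a)) b"
    using assms by (auto simp: lookup_sum lookup_single when_def in_keys_iff)
qed

text \<open>
  The linear functional with value \<open>w a\<close> on the basis vector at \<open>a\<close>.  Evaluation of polynomials at
  a point, the sign functional that separates SONC from nonnegative forms, and the functionals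
  on exponent space that bound convex hulls are all of this kind.
\<close>

definition lin_ext :: "('a \<Rightarrow> real) \<Rightarrow> ('a \<Rightarrow>\<^sub>0 real) \<Rightarrow> real" where
  "lin_ext w f = (\<Sum>a\<in>Poly_Mapping.keys f. Poly_Mapping.lookup f a * w a)"

lemma lin_ext_superset:
  assumes "finite S" "Poly_Mapping.keys f \<subseteq> S"
  shows "lin_ext w f = (\<Sum>a\<in>S. Poly_Mapping.lookup f a * w a)"
  unfolding lin_ext_def using assms
  by (intro sum.mono_neutral_left) (auto simp: in_keys_iff)

lemma lin_ext_add: "lin_ext w (f + g) = lin_ext w f + lin_ext w g"
proof -
  let ?S = "Poly_Mapping.keys f \<union> Poly_Mapping.keys g"
  have "Poly_Mapping.keys (f + g) \<subseteq> ?S"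
    by (rule keys_add)
  then show ?thesis
    by (subst (1 2 3) lin_ext_superset[of ?S])
       (auto simp: lookup_add distrib_right sum.distrib)
qed

lemma lin_ext_scaleR: "lin_ext w (r *\<^sub>R f) = r * lin_ext w f"
proof -
  have "Poly_Mapping.keys (r *\<^sub>R f) \<subseteq> Poly_Mapping.keys f"
    by (auto simp: in_keys_iff lookup_scaleR)
  then show ?thesis
    by (subst (1 2) lin_ext_superset[of "Poly_Mapping.keys f"])
       (auto simp: lookup_scaleR sum_distrib_left mult.assoc)
qed

lemma lin_ext_zero: "lin_ext w 0 = 0"
  by (simp add: lin_ext_def)

lemma lin_ext_single: "lin_ext w (Poly_Mapping.single a c) = c * w a"
  by (subst lin_ext_superset[of "{a}"]) (auto simp: lookup_single)

lemma lin_ext_sum: "lin_ext w (\<Sum>i\<in>I. f i) = (\<Sum>i\<in>I. lin_ext w (f i))"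
  by (induction I rule: infinite_finite_induct) (auto simp: lin_ext_zero lin_ext_add)

lemma lin_ext_sum_list: "lin_ext w (sum_list gs) = (\<Sum>g\<leftarrow>gs. lin_ext w g)"
  by (induction gs) (auto simp: lin_ext_zero lin_ext_add)

lemmas lin_ext_simps = lin_ext_add lin_ext_scaleR lin_ext_single lin_ext_sum

section \<open>Monomials and permutations of variables\<close>

definition monomial :: "(nat \<Rightarrow> real) \<Rightarrow> expo \<Rightarrow> real" where
  "monomial x \<alpha> = (\<Prod>i\<in>Poly_Mapping.keys \<alpha>. x i ^ Poly_Mapping.lookup \<alpha> i)"

lemma monomial_superset:
  assumes "finite S" "Poly_Mapping.keys \<alpha> \<subseteq> S"
  shows "monomial x \<alpha> = (\<Prod>i\<in>S. x i ^ Poly_Mapping.lookup \<alpha> i)"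
  unfolding monomial_def using assms
  by (intro prod.mono_neutral_left) (auto simp: in_keys_iff)

lemma monomial_add: "monomial x (\<alpha> + \<beta>) = monomial x \<alpha> * monomial x \<beta>"
proof -
  let ?S = "Poly_Mapping.keys \<alpha> \<union> Poly_Mapping.keys \<beta>"
  have "Poly_Mapping.keys (\<alpha> + \<beta>) \<subseteq> ?S"
    by (rule keys_add)
  then show ?thesis
    by (subst (1 2 3) monomial_superset[of ?S])
       (auto simp: lookup_add power_add prod.distrib)
qed

lemma monomial_single: "monomial x (Poly_Mapping.single i m) = x i ^ m"
  by (subst monomial_superset[of "{i}"]) (auto simp: lookup_single)

lemma abs_monomial: "\<bar>monomial x \<alpha>\<bar> = monomial (\<lambda>i. \<bar>x i\<bar>) \<alpha>"
  by (simp add: monomial_def abs_prod power_abs)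

lemma monomial_eq_abs_if_even:
  assumes "\<alpha> \<in> even_expos"
  shows "monomial x \<alpha> = \<bar>monomial x \<alpha>\<bar>"
proof -
  have "0 \<le> monomial x \<alpha>"
    unfolding monomial_def using assms
    by (intro prod_nonneg) (auto simp: even_expos_def zero_le_even_power)
  then show ?thesis by simp
qed

lemma poly_eval_eq_lin_ext: "poly_eval x f = lin_ext (monomial x) f"
  by (simp add: poly_eval_def lin_ext_def monomial_def)

text \<open>
  This is composition with \<open>\<pi>\<close>, hence a right action of the permutations.
\<close>

definition perm_expo :: "(nat \<Rightarrow> nat) \<Rightarrow> expo \<Rightarrow> expo" where
  "perm_expo \<pi> \<alpha> = Poly_Mapping.map_key \<pi> \<alpha>"

lemma lookup_perm_expo:
  "inj \<pi> \<Longrightarrow> Poly_Mapping.lookup (perm_expo \<pi> \<alpha>) = Poly_Mapping.lookup \<alpha> \<circ> \<pi>"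
  by (simp add: perm_expo_def map_key.rep_eq)

lemma perm_expo_comp:
  "inj \<pi> \<Longrightarrow> inj \<sigma> \<Longrightarrow> perm_expo \<pi> (perm_expo \<sigma> \<alpha>) = perm_expo (\<sigma> \<circ> \<pi>) \<alpha>"
  by (simp add: perm_expo_def map_key_compose)

lemma perm_expo_id: "perm_expo id \<alpha> = \<alpha>"
  by (rule poly_mapping_eqI) (simp add: lookup_perm_expo)

lemma perm_expo_inverses:
  assumes "bij \<pi>"
  shows "perm_expo \<pi> (perm_expo (inv \<pi>) \<alpha>) = \<alpha>" "perm_expo (inv \<pi>) (perm_expo \<pi> \<alpha>) = \<alpha>"
proof -
  have "inj \<pi>" "inj (inv \<pi>)"
    using assms by (auto simp: bij_is_inj bij_imp_bij_inv)
  moreover have "inv \<pi> \<circ> \<pi> = id" "\<pi> \<circ> inv \<pi> = id"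
    using assms bij_is_inj bij_is_surj surj_iff by (auto simp flip: inj_iff surj_iff)
  ultimately show "perm_expo \<pi> (perm_expo (inv \<pi>) \<alpha>) = \<alpha>"
      "perm_expo (inv \<pi>) (perm_expo \<pi> \<alpha>) = \<alpha>"
    by (simp_all add: perm_expo_comp perm_expo_id)
qed

lemma inj_perm_expo: "bij \<pi> \<Longrightarrow> inj (perm_expo \<pi>)"
  by (metis injI perm_expo_inverses(2))

lemma keys_perm_expo: "inj \<pi> \<Longrightarrow> Poly_Mapping.keys (perm_expo \<pi> \<alpha>) = \<pi> -` Poly_Mapping.keys \<alpha>"
  by (auto simp: in_keys_iff lookup_perm_expo)

text \<open>
  Stated for the inverse, because \<open>perm_expo\<close> composes with a permutation of the indices while a
  unit vector is moved by its image.
\<close>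

lemma perm_expo_single:
  assumes "bij \<sigma>"
  shows "perm_expo (inv \<sigma>) (Poly_Mapping.single a m) = Poly_Mapping.single (\<sigma> a) m"
proof (rule poly_mapping_eqI)
  fix i
  have "inj (inv \<sigma>)" "inv \<sigma> i = a \<longleftrightarrow> i = \<sigma> a"
    using assms by (auto simp: bij_is_inj bij_imp_bij_inv bij_inv_eq_iff)
  then show "Poly_Mapping.lookup (perm_expo (inv \<sigma>) (Poly_Mapping.single a m)) i
      = Poly_Mapping.lookup (Poly_Mapping.single (\<sigma> a) m) i"
    by (auto simp: lookup_perm_expo lookup_single when_def)
qed

lemma perm_expo_add: "inj \<pi> \<Longrightarrow> perm_expo \<pi> (\<alpha> + \<beta>) = perm_expo \<pi> \<alpha> + perm_expo \<pi> \<beta>"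
  by (simp add: perm_expo_def map_key_plus)

lemma perm_expo_even_iff:
  assumes "bij \<pi>"
  shows "perm_expo \<pi> \<alpha> \<in> even_expos \<longleftrightarrow> \<alpha> \<in> even_expos"
proof -
  have "inj \<pi>" "surj \<pi>"
    using assms by (auto simp: bij_is_inj bij_is_surj)
  then show ?thesis
    unfolding even_expos_def mem_Collect_eq lookup_perm_expo[OF \<open>inj \<pi>\<close>] o_def
    by (metis surjD)
qed

lemma monomial_perm_expo:
  assumes "bij \<pi>"
  shows "monomial x (perm_expo \<pi> \<alpha>) = monomial (x \<circ> inv \<pi>) \<alpha>"
proof -
  have inj: "inj \<pi>" using assms by (rule bij_is_inj)
  have "bij_betw \<pi> (\<pi> -` Poly_Mapping.keys \<alpha>) (Poly_Mapping.keys \<alpha>)"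
    using assms inj unfolding bij_betw_def
    by (auto simp: bij_is_surj surj_image_vimage_eq intro: inj_on_subset)
  then have "(\<Prod>i\<in>\<pi> -` Poly_Mapping.keys \<alpha>. (x \<circ> inv \<pi>) (\<pi> i) ^ Poly_Mapping.lookup \<alpha> (\<pi> i))
      = monomial (x \<circ> inv \<pi>) \<alpha>"
    unfolding monomial_def by (rule prod.reindex_bij_betw)
  then show ?thesis
    using inj by (simp add: monomial_def keys_perm_expo lookup_perm_expo)
qed

text \<open>
  The coefficient at \<open>perm_expo \<pi> \<alpha>\<close> is the one that \<open>f\<close> has at \<open>\<alpha>\<close>, so every monomial is moved
  along \<open>perm_expo \<pi>\<close>.
\<close>

definition perm_poly :: "(nat \<Rightarrow> nat) \<Rightarrow> rpoly \<Rightarrow> rpoly" where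
  "perm_poly \<pi> f = Poly_Mapping.map_key (perm_expo (inv \<pi>)) f"

lemma lookup_perm_poly:
  "bij \<pi> \<Longrightarrow> Poly_Mapping.lookup (perm_poly \<pi> f) \<gamma> = Poly_Mapping.lookup f (perm_expo (inv \<pi>) \<gamma>)"
  by (simp add: perm_poly_def map_key.rep_eq inj_perm_expo bij_imp_bij_inv)

lemma perm_poly_add: "bij \<pi> \<Longrightarrow> perm_poly \<pi> (f + g) = perm_poly \<pi> f + perm_poly \<pi> g"
  by (rule poly_mapping_eqI) (simp add: lookup_perm_poly lookup_add)

lemma perm_poly_scaleR: "bij \<pi> \<Longrightarrow> perm_poly \<pi> (r *\<^sub>R f) = r *\<^sub>R perm_poly \<pi> f"
  by (rule poly_mapping_eqI) (simp add: lookup_perm_poly lookup_scaleR)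

lemma perm_poly_zero: "bij \<pi> \<Longrightarrow> perm_poly \<pi> 0 = 0"
  by (rule poly_mapping_eqI) (simp add: lookup_perm_poly)

lemma perm_poly_sum: "bij \<pi> \<Longrightarrow> perm_poly \<pi> (\<Sum>i\<in>I. f i) = (\<Sum>i\<in>I. perm_poly \<pi> (f i))"
  by (induction I rule: infinite_finite_induct) (auto simp: perm_poly_zero perm_poly_add)

lemma perm_poly_single:
  assumes "bij \<pi>"
  shows "perm_poly \<pi> (Poly_Mapping.single \<alpha> c) = Poly_Mapping.single (perm_expo \<pi> \<alpha>) c"
proof (rule poly_mapping_eqI)
  fix \<gamma>
  have "\<alpha> = perm_expo (inv \<pi>) \<gamma> \<longleftrightarrow> perm_expo \<pi> \<alpha> = \<gamma>"
    using perm_expo_inverses[OF assms] by metis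
  then show "Poly_Mapping.lookup (perm_poly \<pi> (Poly_Mapping.single \<alpha> c)) \<gamma>
      = Poly_Mapping.lookup (Poly_Mapping.single (perm_expo \<pi> \<alpha>) c) \<gamma>"
    using assms by (simp add: lookup_perm_poly lookup_single when_def)
qed

lemma keys_perm_poly:
  assumes "bij \<pi>"
  shows "Poly_Mapping.keys (perm_poly \<pi> f) = perm_expo \<pi> ` Poly_Mapping.keys f"
proof -
  have "\<gamma> \<in> Poly_Mapping.keys (perm_poly \<pi> f) \<longleftrightarrow> \<gamma> \<in> perm_expo \<pi> ` Poly_Mapping.keys f" for \<gamma>
    unfolding in_keys_iff lookup_perm_poly[OF assms] image_iff Bex_def
    using perm_expo_inverses[OF assms] by metis
  then show ?thesis by blast
qed

text \<open>
  Permuting exponents amounts to permuting the coordinates of the point, which is why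
  nonnegativity is invariant.
\<close>

lemma poly_eval_perm_poly:
  assumes "bij \<pi>"
  shows "poly_eval x (perm_poly \<pi> f) = poly_eval (x \<circ> inv \<pi>) f"
proof -
  have "poly_eval x (perm_poly \<pi> f)
      = (\<Sum>\<alpha>\<in>Poly_Mapping.keys f. Poly_Mapping.lookup f \<alpha> * monomial x (perm_expo \<pi> \<alpha>))"
    using assms inj_perm_expo[OF assms]
    by (simp add: poly_eval_eq_lin_ext lin_ext_def keys_perm_poly sum.reindex inj_on_subset
        lookup_perm_poly perm_expo_inverses)
  then show ?thesis
    using assms by (simp add: poly_eval_eq_lin_ext lin_ext_def monomial_perm_expo)
qed

lemma perm_poly_comp:
  assumes "bij \<pi>" "bij \<sigma>"
  shows "perm_poly \<pi> (perm_poly \<sigma> f) = perm_poly (\<sigma> \<circ> \<pi>) f"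
proof (rule poly_mapping_eqI)
  fix \<gamma>
  have "inv (\<sigma> \<circ> \<pi>) = inv \<pi> \<circ> inv \<sigma>"
    using assms by (intro o_inv_distrib) auto
  then show "Poly_Mapping.lookup (perm_poly \<pi> (perm_poly \<sigma> f)) \<gamma>
      = Poly_Mapping.lookup (perm_poly (\<sigma> \<circ> \<pi>) f) \<gamma>"
    using assms bij_comp[OF assms]
    by (simp add: lookup_perm_poly perm_expo_comp bij_is_inj bij_imp_bij_inv)
qed

section \<open>Orbits of exponents\<close>

lemma orbit_eq: "orbit k \<alpha> = (\<lambda>\<pi>. perm_expo \<pi> \<alpha>) ` {\<pi>. \<pi> permutes {..<k}}"
  unfolding orbit_def
  by (auto simp: poly_mapping_eq_iff image_iff lookup_perm_expo permutes_inj)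

lemma finite_orbit: "finite (orbit k \<alpha>)"
  by (simp add: orbit_eq finite_permutations)

lemma orbit_refl: "\<alpha> \<in> orbit k \<alpha>"
  unfolding orbit_eq by (rule image_eqI[of _ _ id]) (auto simp: perm_expo_id permutes_id)

lemma orbit_trans:
  assumes "\<beta> \<in> orbit k \<alpha>" "\<gamma> \<in> orbit k \<beta>"
  shows "\<gamma> \<in> orbit k \<alpha>"
proof -
  obtain \<pi> \<sigma> where "\<pi> permutes {..<k}" "\<beta> = perm_expo \<pi> \<alpha>" "\<sigma> permutes {..<k}" "\<gamma> = perm_expo \<sigma> \<beta>"
    using assms by (auto simp: orbit_eq)
  then show ?thesis
    unfolding orbit_eq
    by (intro image_eqI[of _ _ "\<pi> \<circ> \<sigma>"]) (auto simp: perm_expo_comp permutes_inj permutes_compose)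
qed

lemma orbit_sym:
  assumes "\<beta> \<in> orbit k \<alpha>"
  shows "\<alpha> \<in> orbit k \<beta>"
proof -
  obtain \<pi> where "\<pi> permutes {..<k}" "\<beta> = perm_expo \<pi> \<alpha>"
    using assms by (auto simp: orbit_eq)
  then show ?thesis
    unfolding orbit_eq
    by (intro image_eqI[of _ _ "inv \<pi>"]) (auto simp: perm_expo_inverses permutes_bij permutes_inv)
qed

lemma orbit_cong: "\<beta> \<in> orbit k \<alpha> \<Longrightarrow> orbit k \<beta> = orbit k \<alpha>"
  using orbit_trans orbit_sym by blast

lemma orbit_mono: "k \<le> l \<Longrightarrow> orbit k \<alpha> \<subseteq> orbit l \<alpha>"
  unfolding orbit_eq by (auto intro!: imageI elim: permutes_subset)

lemma orbit_subset_expos: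
  assumes "\<alpha> \<in> expos k"
  shows "orbit k \<alpha> \<subseteq> expos k"
  using assms unfolding orbit_eq expos_def
  by (auto simp: keys_perm_expo permutes_inj) (metis lessThan_iff permutes_in_image subsetD)

lemma expos_mono: "k \<le> l \<Longrightarrow> expos k \<subseteq> expos l"
  by (auto simp: expos_def)

lemma orbit_even_iff: "\<beta> \<in> orbit k \<alpha> \<Longrightarrow> \<beta> \<in> even_expos \<longleftrightarrow> \<alpha> \<in> even_expos"
  by (auto simp: orbit_eq perm_expo_even_iff permutes_bij)

section \<open>Symmetrization and monomial means\<close>

definition sym_avg :: "nat \<Rightarrow> rpoly \<Rightarrow> rpoly" where
  "sym_avg k f = (\<Sum>\<pi> | \<pi> permutes {..<k}. (1 / fact k) *\<^sub>R perm_poly \<pi> f)"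

lemma sym_avg_add: "sym_avg k (f + g) = sym_avg k f + sym_avg k g"
  by (simp add: sym_avg_def perm_poly_add permutes_bij scaleR_add_right sum.distrib)

lemma sym_avg_scaleR: "sym_avg k (r *\<^sub>R f) = r *\<^sub>R sym_avg k f"
  by (simp add: sym_avg_def perm_poly_scaleR permutes_bij scaleR_sum_right mult.commute)

lemma sym_avg_sum: "sym_avg k (\<Sum>i\<in>I. f i) = (\<Sum>i\<in>I. sym_avg k (f i))"
  unfolding sym_avg_def
  by (subst sum.swap) (simp add: perm_poly_sum permutes_bij scaleR_sum_right)

lemma sym_avg_perm_poly:
  assumes "\<sigma> permutes {..<k}"
  shows "sym_avg k (perm_poly \<sigma> f) = sym_avg k f"
proof -
  have "sym_avg k f = (\<Sum>\<pi> | \<pi> permutes {..<k}. (1 / fact k) *\<^sub>R perm_poly (\<sigma> \<circ> \<pi>) f)"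
    unfolding sym_avg_def by (rule setum_permutations_compose_left[OF assms])
  also have "\<dots> = sym_avg k (perm_poly \<sigma> f)"
    using assms by (simp add: sym_avg_def perm_poly_comp permutes_bij)
  finally show ?thesis by simp
qed

lemma sym_avg_fixed:
  assumes "\<And>\<pi>. \<pi> permutes {..<k} \<Longrightarrow> perm_poly \<pi> f = f"
  shows "sym_avg k f = f"
proof -
  have "sym_avg k f = real (card {\<pi>. \<pi> permutes {..<k}}) *\<^sub>R ((1 / fact k) *\<^sub>R f)"
    using assms by (simp add: sym_avg_def sum_constant_scaleR del: sum_constant)
  then show ?thesis
    by (simp add: card_permutations[of _ k])
qed

lemma perm_poly_monom_sym:
  assumes "\<pi> permutes {..<k}"
  shows "perm_poly \<pi> (monom_sym k \<alpha>) = monom_sym k \<alpha>"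
proof -
  have bij: "bij \<pi>" using assms by (rule permutes_bij)
  have inj: "inj_on (perm_expo \<pi>) (orbit k \<alpha>)"
    using inj_perm_expo[OF bij] by (rule inj_on_subset) simp
  have "perm_expo \<pi> ` orbit k \<alpha> \<subseteq> orbit k \<alpha>"
  proof (intro image_subsetI)
    fix \<beta> assume "\<beta> \<in> orbit k \<alpha>"
    then show "perm_expo \<pi> \<beta> \<in> orbit k \<alpha>"
      by (rule orbit_trans) (use assms in \<open>auto simp: orbit_eq\<close>)
  qed
  then have "perm_expo \<pi> ` orbit k \<alpha> = orbit k \<alpha>"
    using finite_orbit inj by (intro endo_inj_surj)
  then have "(\<Sum>\<beta>\<in>orbit k \<alpha>. Poly_Mapping.single (perm_expo \<pi> \<beta>) (1::real)) = monom_sym k \<alpha>"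
    unfolding monom_sym_def using inj by (metis (no_types, lifting) sum.reindex_cong)
  then show ?thesis
    by (simp add: monom_sym_def perm_poly_sum perm_poly_single bij)
qed

lemma monomial_ones: "\<alpha> \<in> expos k \<Longrightarrow> monomial (indicator {..<k}) \<alpha> = 1"
  unfolding monomial_def expos_def by (intro prod.neutral) (auto simp: indicator_def)

lemma monom_mean_eq:
  assumes "\<alpha> \<in> expos k"
  shows "monom_mean k \<alpha> = monom_sym k \<alpha> /\<^sub>R real (card (orbit k \<alpha>))"
proof -
  have "poly_eval (indicator {..<k}) (monom_sym k \<alpha>) = real (card (orbit k \<alpha>))"
    using orbit_subset_expos[OF assms]
    by (auto simp: poly_eval_eq_lin_ext monom_sym_def lin_ext_simps monomial_ones subset_iff)
  then show ?thesis by (simp add: monom_mean_def)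
qed

lemma card_orbit_nonzero: "card (orbit k \<alpha>) \<noteq> 0"
  using orbit_refl finite_orbit by (metis card_0_eq empty_iff)

text \<open>
  The average takes the same value on every monomial of the orbit, and it fixes the sum of these
  monomials; so this value is the sum divided by the size of the orbit.
\<close>

lemma sym_avg_single:
  assumes "\<alpha> \<in> expos k"
  shows "sym_avg k (Poly_Mapping.single \<alpha> 1) = monom_mean k \<alpha>"
proof -
  have "sym_avg k (Poly_Mapping.single \<beta> 1) = sym_avg k (Poly_Mapping.single \<alpha> 1)"
    if "\<beta> \<in> orbit k \<alpha>" for \<beta>
    using that sym_avg_perm_poly[of _ k "Poly_Mapping.single \<alpha> 1"]
    by (auto simp: orbit_eq perm_poly_single permutes_bij)
  then have "sym_avg k (monom_sym k \<alpha>)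
      = real (card (orbit k \<alpha>)) *\<^sub>R sym_avg k (Poly_Mapping.single \<alpha> 1)"
    by (simp add: monom_sym_def sym_avg_sum sum_constant_scaleR del: sum_constant)
  moreover have "sym_avg k (monom_sym k \<alpha>) = monom_sym k \<alpha>"
    by (intro sym_avg_fixed perm_poly_monom_sym)
  ultimately show ?thesis
    using assms card_orbit_nonzero by (simp add: monom_mean_eq)
qed

lemma monom_mean_cong:
  "\<beta> \<in> orbit k \<alpha> \<Longrightarrow> monom_mean k \<beta> = monom_mean k \<alpha>"
  by (simp add: monom_mean_def monom_sym_def orbit_cong)

text \<open>
  A mean over the orbit under the permutations of \<open>k\<close> variables only involves monomials from a
  single orbit under the permutations of \<open>l\<close> variables, and these have the same average.
\<close>

lemma sym_avg_monom_mean: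
  assumes "\<alpha> \<in> expos k" "k \<le> l"
  shows "sym_avg l (monom_mean k \<alpha>) = monom_mean l \<alpha>"
proof -
  have "sym_avg l (Poly_Mapping.single \<beta> 1) = monom_mean l \<alpha>" if "\<beta> \<in> orbit k \<alpha>" for \<beta>
  proof -
    have "\<beta> \<in> orbit l \<alpha>" "\<beta> \<in> expos l"
      using that assms orbit_mono expos_mono orbit_subset_expos by blast+
    then show ?thesis
      by (simp add: sym_avg_single monom_mean_cong)
  qed
  then show ?thesis
    using assms card_orbit_nonzero
    by (simp add: monom_mean_eq[of \<alpha> k] monom_sym_def sym_avg_scaleR sym_avg_sum sum_constant_scaleR del: sum_constant)
qed


section \<open>AG and SONC polynomials\<close>

lemma finite_sym_support: "finite T \<Longrightarrow> finite (sym_support k T)"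
  by (simp add: sym_support_def finite_orbit)

lemma sym_support_subset_expos: "T \<subseteq> expos k \<Longrightarrow> sym_support k T \<subseteq> expos k"
  using orbit_subset_expos by (fastforce simp: sym_support_def)

lemma sym_support_mono: "k \<le> l \<Longrightarrow> sym_support k T \<subseteq> sym_support l T"
  using orbit_mono unfolding sym_support_def by blast

lemma perm_expo_sym_support:
  assumes "\<pi> permutes {..<k}"
  shows "perm_expo \<pi> \<alpha> \<in> sym_support k T \<longleftrightarrow> \<alpha> \<in> sym_support k T"
proof -
  have mem: "perm_expo \<pi> \<alpha> \<in> orbit k \<alpha>"
    using assms by (auto simp: orbit_eq)
  have "perm_expo \<pi> \<alpha> \<in> orbit k \<tau> \<longleftrightarrow> \<alpha> \<in> orbit k \<tau>" for \<tau>
    using orbit_trans[OF _ mem] orbit_trans[OF _ orbit_sym[OF mem]] by blast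
  then show ?thesis
    by (simp add: sym_support_def)
qed

lemma sym_support_invariant:
  assumes "sym_invariant n T"
  shows "sym_support n T = T"
  using assms orbit_refl unfolding sym_invariant_def sym_support_def by blast

text \<open>
  A description by the coefficients of the polynomial itself, from which the invariance of the AG
  property can be read off without choosing a representation.
\<close>

lemma ag_poly_iff:
  assumes "finite U"
  shows "ag_poly k U f \<longleftrightarrow> nonneg_poly k f \<and> Poly_Mapping.keys f \<subseteq> U \<and>
    (\<exists>\<beta>\<in>U. \<forall>\<alpha>\<in>U - {\<beta>}. 0 \<le> Poly_Mapping.lookup f \<alpha> \<and>
       (\<alpha> \<notin> even_expos \<longrightarrow> Poly_Mapping.lookup f \<alpha> = 0))"
    (is "_ \<longleftrightarrow> ?rhs")
proof -
  have split: "(\<Sum>\<alpha>\<in>U - {\<beta>}. Poly_Mapping.single \<alpha> (c \<alpha>)) + Poly_Mapping.single \<beta> (c \<beta>)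
      = (\<Sum>\<alpha>\<in>U. Poly_Mapping.single \<alpha> (c \<alpha>))" if "\<beta> \<in> U" for \<beta> and c :: "expo \<Rightarrow> real"
    using sum.remove[OF assms that, of "\<lambda>\<alpha>. Poly_Mapping.single \<alpha> (c \<alpha>)"] by (simp add: add.commute)
  have coeff: "Poly_Mapping.lookup (\<Sum>\<alpha>\<in>U. Poly_Mapping.single \<alpha> (c \<alpha>)) \<gamma> = (if \<gamma> \<in> U then c \<gamma> else 0)"
    for \<gamma> and c :: "expo \<Rightarrow> real"
    using assms by (simp add: lookup_sum lookup_single when_def)
  show ?thesis
  proof
    assume "ag_poly k U f"
    then obtain \<beta> c where nonneg: "nonneg_poly k f" and \<beta>: "\<beta> \<in> U"
      and f': "f = (\<Sum>\<alpha>\<in>U - {\<beta>}. Poly_Mapping.single \<alpha> (c \<alpha>)) + Poly_Mapping.single \<beta> (c \<beta>)"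
      and c: "\<forall>\<alpha>\<in>U - {\<beta>}. 0 \<le> c \<alpha>" "\<forall>\<alpha>\<in>U - {\<beta>}. \<alpha> \<notin> even_expos \<longrightarrow> c \<alpha> = 0"
      unfolding ag_poly_def by (elim conjE bexE exE) (rule that; assumption)
    have f: "f = (\<Sum>\<alpha>\<in>U. Poly_Mapping.single \<alpha> (c \<alpha>))"
      unfolding f' using \<beta> by (rule split)
    note nonneg \<beta> c
    moreover have "Poly_Mapping.keys f \<subseteq> U"
      by (auto simp: f in_keys_iff coeff split: if_splits)
    moreover have "Poly_Mapping.lookup f \<alpha> = c \<alpha>" if "\<alpha> \<in> U" for \<alpha>
      using that by (simp add: f coeff)
    ultimately show ?rhs
      by (intro conjI bexI[of _ \<beta>] ballI) simp_all
  next
    assume rhs: ?rhs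
    then obtain \<beta> where \<beta>: "\<beta> \<in> U" and "\<forall>\<alpha>\<in>U - {\<beta>}. 0 \<le> Poly_Mapping.lookup f \<alpha> \<and>
       (\<alpha> \<notin> even_expos \<longrightarrow> Poly_Mapping.lookup f \<alpha> = 0)"
      by blast
    moreover have "f = (\<Sum>\<alpha>\<in>U. Poly_Mapping.single \<alpha> (Poly_Mapping.lookup f \<alpha>))"
      using assms rhs by (intro poly_mapping_sum_singles) auto
    ultimately show "ag_poly k U f"
      unfolding ag_poly_def using rhs split[OF \<beta>]
      by (intro conjI bexI[of _ \<beta>] exI[of _ "Poly_Mapping.lookup f"]) auto
  qed
qed

lemma ag_polyE:
  assumes "finite U" "ag_poly k U f"
  obtains \<beta> where "nonneg_poly k f" "Poly_Mapping.keys f \<subseteq> U" "\<beta> \<in> U"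
    "\<forall>\<alpha>\<in>U - {\<beta>}. 0 \<le> Poly_Mapping.lookup f \<alpha> \<and>
       (\<alpha> \<notin> even_expos \<longrightarrow> Poly_Mapping.lookup f \<alpha> = 0)"
  using assms(2) unfolding ag_poly_iff[OF assms(1)] by (elim conjE bexE) (rule that; assumption)

lemma ag_poly_scaleR:
  assumes "finite U" "ag_poly k U f" "0 \<le> r"
  shows "ag_poly k U (r *\<^sub>R f)"
proof -
  have "nonneg_poly k (r *\<^sub>R f)"
    using assms by (auto simp: ag_poly_def nonneg_poly_def poly_eval_eq_lin_ext lin_ext_scaleR)
  moreover have "Poly_Mapping.keys (r *\<^sub>R f) \<subseteq> Poly_Mapping.keys f"
    by (auto simp: in_keys_iff lookup_scaleR)
  moreover obtain \<beta> where "Poly_Mapping.keys f \<subseteq> U" "\<beta> \<in> U"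
    "\<forall>\<alpha>\<in>U - {\<beta>}. 0 \<le> Poly_Mapping.lookup f \<alpha> \<and>
       (\<alpha> \<notin> even_expos \<longrightarrow> Poly_Mapping.lookup f \<alpha> = 0)"
    by (rule ag_polyE[OF assms(1,2)], rule that)
  ultimately show ?thesis
    unfolding ag_poly_iff[OF assms(1)] using \<open>0 \<le> r\<close>
    by (intro conjI bexI[of _ \<beta>]) (auto simp: lookup_scaleR)
qed

lemma points_perm:
  assumes "\<pi> permutes {..<k}" "x \<in> points k"
  shows "x \<circ> inv \<pi> \<in> points k"
  using assms permutes_inv[OF assms(1)] by (auto simp: points_def permutes_not_in)

lemma ag_poly_perm:
  assumes "finite T" "\<pi> permutes {..<k}" and ag: "ag_poly k (sym_support k T) f"
  shows "ag_poly k (sym_support k T) (perm_poly \<pi> f)"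
proof -
  let ?U = "sym_support k T"
  note U = perm_expo_sym_support[OF assms(2)] finite_sym_support[OF assms(1)]
  have bij: "bij \<pi>" using assms(2) by (rule permutes_bij)
  obtain \<beta> where "nonneg_poly k f" "Poly_Mapping.keys f \<subseteq> ?U" "\<beta> \<in> ?U"
    and \<beta>: "\<forall>\<alpha>\<in>?U - {\<beta>}. 0 \<le> Poly_Mapping.lookup f \<alpha> \<and>
       (\<alpha> \<notin> even_expos \<longrightarrow> Poly_Mapping.lookup f \<alpha> = 0)"
    by (rule ag_polyE[OF U(2) ag], rule that)
  have "nonneg_poly k (perm_poly \<pi> f)"
    using \<open>nonneg_poly k f\<close> points_perm[OF assms(2)]
    by (auto simp: nonneg_poly_def poly_eval_perm_poly[OF bij])
  moreover have "Poly_Mapping.keys (perm_poly \<pi> f) \<subseteq> ?U"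
    using \<open>Poly_Mapping.keys f \<subseteq> ?U\<close> U by (auto simp: keys_perm_poly[OF bij])
  moreover have "perm_expo \<pi> \<beta> \<in> ?U"
    using \<open>\<beta> \<in> ?U\<close> U by simp
  moreover have "0 \<le> Poly_Mapping.lookup (perm_poly \<pi> f) \<alpha> \<and>
      (\<alpha> \<notin> even_expos \<longrightarrow> Poly_Mapping.lookup (perm_poly \<pi> f) \<alpha> = 0)"
    if "\<alpha> \<in> ?U - {perm_expo \<pi> \<beta>}" for \<alpha>
  proof -
    have "perm_expo (inv \<pi>) \<alpha> \<in> ?U - {\<beta>}"
      using that U(1)[of "perm_expo (inv \<pi>) \<alpha>"] perm_expo_inverses[OF bij] by auto
    then show ?thesis
      using \<beta> bij by (simp add: lookup_perm_poly perm_expo_even_iff bij_imp_bij_inv)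
  qed
  ultimately show ?thesis
    unfolding ag_poly_iff[OF U(2)] by (intro conjI bexI[of _ "perm_expo \<pi> \<beta>"]) auto
qed

lemma poly_eval_cong:
  assumes "Poly_Mapping.keys f \<subseteq> expos k" "\<And>i. i < k \<Longrightarrow> x i = y i"
  shows "poly_eval x f = poly_eval y f"
proof -
  have "monomial x \<alpha> = monomial y \<alpha>" if "\<alpha> \<in> Poly_Mapping.keys f" for \<alpha>
    unfolding monomial_def
  proof (intro prod.cong refl)
    fix i assume "i \<in> Poly_Mapping.keys \<alpha>"
    then have "i < k" using that assms(1) by (auto simp: expos_def)
    then show "x i ^ Poly_Mapping.lookup \<alpha> i = y i ^ Poly_Mapping.lookup \<alpha> i"
      using assms(2) by simp
  qed
  then show ?thesis
    by (simp add: poly_eval_eq_lin_ext lin_ext_def)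
qed

lemma nonneg_poly_more_variables:
  assumes "Poly_Mapping.keys f \<subseteq> expos k" "nonneg_poly k f"
  shows "nonneg_poly l f"
  unfolding nonneg_poly_def
proof
  fix x
  have "poly_eval x f = poly_eval (\<lambda>i. if i < k then x i else 0) f"
    using assms(1) by (rule poly_eval_cong) simp
  then show "0 \<le> poly_eval x f"
    using assms(2) by (auto simp: nonneg_poly_def points_def)
qed

text \<open>
  The polynomial does not depend on the new variables, so it stays nonnegative, and the larger
  support set contains the smaller one.
\<close>

lemma ag_poly_more_variables:
  assumes "finite T" "T \<subseteq> expos k" "k \<le> l" and ag: "ag_poly k (sym_support k T) f"
  shows "ag_poly l (sym_support l T) f"
proof -
  note fin = finite_sym_support[OF assms(1)]
  obtain \<beta> where f: "nonneg_poly k f" "Poly_Mapping.keys f \<subseteq> sym_support k T"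
    and \<beta>: "\<beta> \<in> sym_support k T" "\<forall>\<alpha>\<in>sym_support k T - {\<beta>}. 0 \<le> Poly_Mapping.lookup f \<alpha> \<and>
       (\<alpha> \<notin> even_expos \<longrightarrow> Poly_Mapping.lookup f \<alpha> = 0)"
    by (rule ag_polyE[OF fin ag], rule that)
  have "nonneg_poly l f"
    using nonneg_poly_more_variables[OF order_trans[OF f(2) sym_support_subset_expos[OF assms(2)]] f(1)] .
  moreover have "0 \<le> Poly_Mapping.lookup f \<alpha> \<and> (\<alpha> \<notin> even_expos \<longrightarrow> Poly_Mapping.lookup f \<alpha> = 0)"
    if "\<alpha> \<noteq> \<beta>" for \<alpha>
  proof (cases "\<alpha> \<in> sym_support k T")
    case True
    then show ?thesis using \<beta>(2) that by blast
  next
    case False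
    then have "Poly_Mapping.lookup f \<alpha> = 0"
      using f(2) by (metis in_keys_iff subsetD)
    then show ?thesis by simp
  qed
  ultimately show ?thesis
    unfolding ag_poly_iff[OF fin] using f(2) \<beta>(1) sym_support_mono[OF assms(3), of T]
    by (intro conjI bexI[of _ \<beta>] ballI) (simp_all add: subset_iff)
qed

lemma sonc_poly_ag: "ag_poly k U f \<Longrightarrow> sonc_poly k U f"
  unfolding sonc_poly_def by (intro exI[of _ "[f]"]) simp

lemma sonc_poly_zero: "sonc_poly k U 0"
  unfolding sonc_poly_def by (intro exI[of _ "[]"]) simp

lemma sonc_poly_add:
  assumes "sonc_poly k U f" "sonc_poly k U g"
  shows "sonc_poly k U (f + g)"
proof -
  obtain fs gs where "\<forall>g\<in>set fs. ag_poly k U g" "f = sum_list fs"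
      "\<forall>g\<in>set gs. ag_poly k U g" "g = sum_list gs"
    using assms unfolding sonc_poly_def by blast
  then show ?thesis
    unfolding sonc_poly_def by (intro exI[of _ "fs @ gs"]) auto
qed

lemma sonc_poly_sum: "(\<And>i. i \<in> I \<Longrightarrow> sonc_poly k U (f i)) \<Longrightarrow> sonc_poly k U (\<Sum>i\<in>I. f i)"
  by (induction I rule: infinite_finite_induct) (auto simp: sonc_poly_zero sonc_poly_add)

text \<open>
  An additive map needs to be checked on AG polynomials only.
\<close>

lemma sonc_poly_map:
  assumes "sonc_poly k U f" "F 0 = 0" "\<And>g h. F (g + h) = F g + F h"
    and "\<And>g. ag_poly k U g \<Longrightarrow> sonc_poly l V (F g)"
  shows "sonc_poly l V (F f)"
proof -
  obtain gs where "\<forall>g\<in>set gs. ag_poly k U g" "f = sum_list gs"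
    using assms(1) unfolding sonc_poly_def by blast
  moreover have "\<forall>g\<in>set gs. ag_poly k U g \<Longrightarrow> sonc_poly l V (F (sum_list gs))"
    using assms(2-4) by (induction gs) (auto simp: sonc_poly_zero sonc_poly_add)
  ultimately show ?thesis by blast
qed

text \<open>
  The average of an AG polynomial is a nonnegative combination of its permuted copies, which are
  again AG.
\<close>

lemma sonc_poly_sym_avg:
  assumes "finite T" "T \<subseteq> expos k" "k \<le> l" "sonc_poly k (sym_support k T) f"
  shows "sonc_poly l (sym_support l T) (sym_avg l f)"
proof (rule sonc_poly_map[OF assms(4)])
  show "sym_avg l 0 = 0"
    using sym_avg_scaleR[of l 0 0] by simp
  show "sym_avg l (g + h) = sym_avg l g + sym_avg l h" for g h
    by (rule sym_avg_add)
  fix g assume "ag_poly k (sym_support k T) g"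
  then have "ag_poly l (sym_support l T) g"
    by (rule ag_poly_more_variables[OF assms(1-3)])
  then show "sonc_poly l (sym_support l T) (sym_avg l g)"
    unfolding sym_avg_def using assms(1)
    by (intro sonc_poly_sum sonc_poly_ag ag_poly_scaleR finite_sym_support ag_poly_perm) auto
qed

section \<open>Monotonicity of the normalized cones\<close>

lemma sym_avg_sym_poly_mean:
  assumes "R \<subseteq> expos k" "k \<le> l"
  shows "sym_avg l (sym_poly monom_mean k R c) = sym_poly monom_mean l R c"
  unfolding sym_poly_def sym_avg_sum sym_avg_scaleR
  using assms by (intro sum.cong) (auto simp: sym_avg_monom_mean)

text \<open>
  Symmetrization turns the form with coefficients \<open>c\<close> in \<open>k\<close> variables into the form with the same
  coefficients in \<open>l\<close> variables.
\<close>

lemma cone_sonc_mean_mono: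
  assumes "finite T" "T \<subseteq> expos k" "R \<subseteq> T" "k \<le> l"
  shows "cone_sonc monom_mean k T R \<subseteq> cone_sonc monom_mean l T R"
proof
  fix c assume "c \<in> cone_sonc monom_mean k T R"
  then have "Poly_Mapping.keys c \<subseteq> R"
      "sonc_poly l (sym_support l T) (sym_avg l (sym_poly monom_mean k R c))"
    using assms sonc_poly_sym_avg by (auto simp: cone_sonc_def)
  then show "c \<in> cone_sonc monom_mean l T R"
    using assms by (simp add: cone_sonc_def sym_avg_sym_poly_mean)
qed

lemma sym_poly_add: "sym_poly B k R (c + d) = sym_poly B k R c + sym_poly B k R d"
  by (simp add: sym_poly_def lookup_add scaleR_add_left sum.distrib)

lemma sym_poly_zero: "sym_poly B k R 0 = 0"
  by (simp add: sym_poly_def)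

lemma sym_poly_sum: "sym_poly B k R (\<Sum>i\<in>I. c i) = (\<Sum>i\<in>I. sym_poly B k R (c i))"
  by (induction I rule: infinite_finite_induct) (auto simp: sym_poly_zero sym_poly_add)

lemma sym_poly_single:
  assumes "finite R" "\<rho> \<in> R"
  shows "sym_poly B k R (Poly_Mapping.single \<rho> r) = r *\<^sub>R B k \<rho>"
proof -
  have "sym_poly B k R (Poly_Mapping.single \<rho> r) = (\<Sum>\<sigma>\<in>R. if \<sigma> = \<rho> then r *\<^sub>R B k \<rho> else 0)"
    unfolding sym_poly_def by (intro sum.cong) (auto simp: lookup_single when_def)
  then show ?thesis using assms by simp
qed

section \<open>Domination of monomials by convex hulls\<close>

text \<open>
  At a positive point \<open>ln (x\<^sup>\<alpha>)\<close> is linear in \<open>\<alpha>\<close>, and a linear functional on a convex hull is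
  bounded by its maximum over the generators.
\<close>

lemma monomial_le_of_hull_positive:
  assumes A: "finite A" "real_vec \<beta> \<in> convex hull (real_vec ` A)" and x: "\<And>i. 0 < x i"
  shows "\<exists>\<alpha>\<in>A. monomial x \<beta> \<le> monomial x \<alpha>"
proof -
  define L where "L = lin_ext (\<lambda>i. ln (x i))"
  have L: "L (real_vec \<alpha>) = ln (monomial x \<alpha>)" for \<alpha>
  proof -
    have lookup: "Poly_Mapping.lookup (real_vec \<alpha>) i = real (Poly_Mapping.lookup \<alpha> i)" for i
      by (simp add: real_vec_def map.rep_eq when_def)
    then have "Poly_Mapping.keys (real_vec \<alpha>) = Poly_Mapping.keys \<alpha>"
      by (auto simp: in_keys_iff)
    then have "L (real_vec \<alpha>) = (\<Sum>i\<in>Poly_Mapping.keys \<alpha>. real (Poly_Mapping.lookup \<alpha> i) * ln (x i))"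
      unfolding L_def lin_ext_def by (simp add: lookup)
    also have "\<dots> = (\<Sum>i\<in>Poly_Mapping.keys \<alpha>. ln (x i ^ Poly_Mapping.lookup \<alpha> i))"
      using x by (intro sum.cong refl) (simp add: ln_realpow)
    also have "\<dots> = ln (monomial x \<alpha>)"
      unfolding monomial_def using x[THEN less_imp_neq] by (subst ln_prod) auto
    finally show ?thesis .
  qed
  have pos: "0 < monomial x \<alpha>" for \<alpha>
    unfolding monomial_def using x by (intro prod_pos) auto
  have "A \<noteq> {}"
    using A(2) by auto
  define m where "m = Max ((\<lambda>\<alpha>. L (real_vec \<alpha>)) ` A)"
  have "convex {v. L v \<le> m}"
  proof (rule convexI)
    fix v w and s t :: real
    assume *: "v \<in> {v. L v \<le> m}" "w \<in> {v. L v \<le> m}" "0 \<le> s" "0 \<le> t" "s + t = 1"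
    then have "s * L v + t * L w \<le> m"
      by (intro convex_bound_le) auto
    then show "s *\<^sub>R v + t *\<^sub>R w \<in> {v. L v \<le> m}"
      by (simp add: L_def lin_ext_simps)
  qed
  moreover have "real_vec ` A \<subseteq> {v. L v \<le> m}"
    using A(1) by (auto simp: m_def)
  ultimately have "L (real_vec \<beta>) \<le> m"
    using A(2) hull_minimal[of "real_vec ` A" "{v. L v \<le> m}" convex] by auto
  moreover obtain \<alpha> where "\<alpha> \<in> A" "L (real_vec \<alpha>) = m"
  proof -
    have "m \<in> (\<lambda>\<alpha>. L (real_vec \<alpha>)) ` A"
      unfolding m_def using A(1) \<open>A \<noteq> {}\<close> by (intro Max_in) auto
    then show ?thesis using that by blast
  qed
  ultimately show ?thesis
    using pos by (auto simp: L intro!: bexI[of _ \<alpha>])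
qed

text \<open>
  Zero coordinates, where the logarithm is not available, are approached from the positive points
  with coordinates \<open>\<bar>x i\<bar> + \<epsilon>\<close>; the single dominating exponent may vary with \<open>\<epsilon>\<close>, which the sum
  absorbs.
\<close>

lemma abs_monomial_le_sum_of_hull:
  assumes A: "finite A" "real_vec \<beta> \<in> convex hull (real_vec ` A)"
  shows "\<bar>monomial x \<beta>\<bar> \<le> (\<Sum>\<alpha>\<in>A. \<bar>monomial x \<alpha>\<bar>)"
proof -
  define y where "y = (\<lambda>\<epsilon> i. \<bar>x i\<bar> + \<epsilon>)"
  have le: "monomial (y \<epsilon>) \<beta> \<le> (\<Sum>\<alpha>\<in>A. monomial (y \<epsilon>) \<alpha>)" if "0 < \<epsilon>" for \<epsilon>
  proof -
    have pos: "0 < y \<epsilon> i" for i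
      using that by (auto simp: y_def intro: add_nonneg_pos)
    then obtain \<alpha> where "\<alpha> \<in> A" "monomial (y \<epsilon>) \<beta> \<le> monomial (y \<epsilon>) \<alpha>"
      using monomial_le_of_hull_positive[OF A] by blast
    moreover have "monomial (y \<epsilon>) \<alpha> \<le> (\<Sum>\<alpha>\<in>A. monomial (y \<epsilon>) \<alpha>)"
      using \<open>\<alpha> \<in> A\<close> A(1) pos
      by (intro member_le_sum) (auto simp: monomial_def intro!: prod_nonneg intro: less_imp_le)
    ultimately show ?thesis by linarith
  qed
  have lim: "((\<lambda>\<epsilon>. monomial (y \<epsilon>) \<alpha>) \<longlongrightarrow> \<bar>monomial x \<alpha>\<bar>) (at_right 0)" for \<alpha>
  proof -
    have "((\<lambda>\<epsilon>. \<Prod>i\<in>Poly_Mapping.keys \<alpha>. (\<bar>x i\<bar> + \<epsilon>) ^ Poly_Mapping.lookup \<alpha> i)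
        \<longlongrightarrow> (\<Prod>i\<in>Poly_Mapping.keys \<alpha>. (\<bar>x i\<bar> + 0) ^ Poly_Mapping.lookup \<alpha> i)) (at_right 0)"
      by (intro tendsto_intros)
    then show ?thesis
      by (simp add: abs_monomial) (simp add: monomial_def y_def)
  qed
  show ?thesis
  proof (rule tendsto_le)
    show "((\<lambda>\<epsilon>. monomial (y \<epsilon>) \<beta>) \<longlongrightarrow> \<bar>monomial x \<beta>\<bar>) (at_right 0)"
      by (rule lim)
    show "((\<lambda>\<epsilon>. \<Sum>\<alpha>\<in>A. monomial (y \<epsilon>) \<alpha>) \<longlongrightarrow> (\<Sum>\<alpha>\<in>A. \<bar>monomial x \<alpha>\<bar>)) (at_right 0)"
      by (intro tendsto_sum lim)
    show "\<forall>\<^sub>F \<epsilon> in at_right 0. monomial (y \<epsilon>) \<beta> \<le> (\<Sum>\<alpha>\<in>A. monomial (y \<epsilon>) \<alpha>)"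
      using le by (simp add: eventually_at_right_field) (use zero_less_one in blast)
  qed simp
qed

lemma ag_poly_even_single:
  assumes "finite U" "\<alpha> \<in> U" "\<alpha> \<in> even_expos"
  shows "ag_poly k U (Poly_Mapping.single \<alpha> 1)"
  unfolding ag_poly_iff[OF assms(1)]
proof (intro conjI bexI[of _ \<alpha>])
  show "nonneg_poly k (Poly_Mapping.single \<alpha> 1)"
    unfolding nonneg_poly_def poly_eval_eq_lin_ext lin_ext_single
    using monomial_eq_abs_if_even[OF assms(3)] by (metis abs_ge_zero mult_1)
qed (use assms in \<open>auto simp: lookup_single\<close>)

text \<open>
  Even monomials equal their absolute values, so their sum outweighs the single odd monomial
  even where that monomial is negative.
\<close>

lemma ag_poly_hull:
  assumes "finite U" "\<beta> \<in> U" "\<beta> \<notin> even_expos"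
    and "real_vec \<beta> \<in> convex hull (real_vec ` (U \<inter> even_expos))"
  shows "ag_poly k U (Poly_Mapping.single \<beta> 1 + (\<Sum>\<alpha>\<in>U \<inter> even_expos. Poly_Mapping.single \<alpha> 1))"
    (is "ag_poly k U ?f")
proof -
  have coeff: "Poly_Mapping.lookup ?f \<alpha>
      = (if \<alpha> = \<beta> \<or> \<alpha> \<in> U \<inter> even_expos then 1 else 0)" for \<alpha>
    using assms(1-3) by (auto simp: lookup_add lookup_sum lookup_single when_def)
  have "0 \<le> poly_eval x ?f" for x
  proof -
    have "(\<Sum>\<alpha>\<in>U \<inter> even_expos. \<bar>monomial x \<alpha>\<bar>) = (\<Sum>\<alpha>\<in>U \<inter> even_expos. monomial x \<alpha>)"
      by (intro sum.cong) (auto simp flip: monomial_eq_abs_if_even)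
    moreover have "\<bar>monomial x \<beta>\<bar> \<le> (\<Sum>\<alpha>\<in>U \<inter> even_expos. \<bar>monomial x \<alpha>\<bar>)"
      using assms by (intro abs_monomial_le_sum_of_hull) auto
    ultimately show ?thesis
      by (simp add: poly_eval_eq_lin_ext lin_ext_simps)
  qed
  then show ?thesis
    unfolding ag_poly_iff[OF assms(1)] nonneg_poly_def using assms
    by (intro conjI bexI[of _ \<beta>]) (auto simp: coeff in_keys_iff split: if_splits)
qed

section \<open>Full dimension of the normalized cones\<close>

lemma cone_dim_full:
  assumes R: "finite R" and C: "\<And>c. c \<in> C \<Longrightarrow> Poly_Mapping.keys c \<subseteq> R"
    and R_C: "\<And>\<rho>. \<rho> \<in> R \<Longrightarrow> Poly_Mapping.single \<rho> 1 \<in> span C"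
  shows "cone_dim C = card R"
proof -
  define E where "E = (\<lambda>\<rho>. Poly_Mapping.single \<rho> (1::real)) ` R"
  have inj: "inj_on (\<lambda>\<rho>. Poly_Mapping.single \<rho> (1::real)) R"
    by (auto simp: inj_on_def poly_mapping_eq_iff fun_eq_iff lookup_single when_def split: if_splits)
  have "C \<subseteq> span E"
  proof
    fix c assume "c \<in> C"
    then have "c = (\<Sum>\<rho>\<in>R. Poly_Mapping.lookup c \<rho> *\<^sub>R Poly_Mapping.single \<rho> 1)"
      using poly_mapping_sum_singles[OF R C] by (simp add: scaleR_single)
    also have "\<dots> \<in> span E"
      by (intro span_sum span_scale span_base) (auto simp: E_def)
    finally show "c \<in> span E" .
  qed
  moreover have "independent E"
  proof (rule independent_if_scalars_zero)
    show "finite E" using R by (simp add: E_def)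
    fix f x assume *: "(\<Sum>x\<in>E. f x *\<^sub>R x) = 0" "x \<in> E"
    then obtain \<rho> where \<rho>: "\<rho> \<in> R" "x = Poly_Mapping.single \<rho> 1" by (auto simp: E_def)
    have "(\<Sum>\<sigma>\<in>R. Poly_Mapping.single \<sigma> (f (Poly_Mapping.single \<sigma> 1))) = 0"
      using * inj by (simp add: E_def sum.reindex scaleR_single)
    then have "Poly_Mapping.lookup (\<Sum>\<sigma>\<in>R. Poly_Mapping.single \<sigma> (f (Poly_Mapping.single \<sigma> 1))) \<rho> = 0"
      by simp
    then show "f x = 0"
      using R \<rho> by (simp add: lookup_sum lookup_single when_def)
  qed
  moreover have "E \<subseteq> span C" using R_C by (auto simp: E_def)
  moreover have "card E = card R" using inj by (simp add: E_def card_image)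
  ultimately have "dim (span C) = card R"
    by (intro dim_unique[of E]) (auto simp: span_minimal)
  then show ?thesis by (simp add: cone_dim_def)
qed

text \<open>
  For an odd exponent the unit vector is a difference of two elements of the cone: the coefficient
  vector of the symmetrized AG polynomial from \<open>ag_poly_hull\<close>, and its part at even exponents.
\<close>

lemma span_cone_sonc_mean:
  assumes adm: "admissible n T R" "origin_compatible T R" and "\<rho> \<in> R"
  shows "Poly_Mapping.single \<rho> 1 \<in> span (cone_sonc monom_mean n T R)" (is "_ \<in> span ?C")
proof -
  have T: "finite T" "T \<subseteq> expos n" "R \<subseteq> T" and U: "sym_support n T = T"
    using adm by (auto simp: admissible_def orbit_reps_def sym_support_invariant)
  have R: "finite R" using T finite_subset by blast
  have even: "Poly_Mapping.single \<sigma> 1 \<in> ?C" if "\<sigma> \<in> R" "\<sigma> \<in> even_expos" for \<sigma>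
  proof -
    have "sonc_poly n (sym_support n T) (sym_avg n (Poly_Mapping.single \<sigma> 1))"
      using that T by (intro sonc_poly_sym_avg[of T n] sonc_poly_ag ag_poly_even_single) (auto simp: U)
    moreover have "sym_avg n (Poly_Mapping.single \<sigma> 1) = sym_poly monom_mean n R (Poly_Mapping.single \<sigma> 1)"
      using that T R by (subst sym_avg_single) (auto simp: sym_poly_single)
    ultimately show ?thesis
      using that by (auto simp: cone_sonc_def)
  qed
  show ?thesis
  proof (cases "\<rho> \<in> even_expos")
    case True
    then show ?thesis using even assms by (simp add: span_base)
  next
    case False
    have "\<forall>\<alpha>\<in>T. \<exists>\<sigma>\<in>R. \<sigma> \<in> orbit n \<alpha>"
      using adm(1) unfolding admissible_def orbit_reps_def by blast
    then obtain rep where rep: "\<And>\<alpha>. \<alpha> \<in> T \<Longrightarrow> rep \<alpha> \<in> R \<and> rep \<alpha> \<in> orbit n \<alpha>"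
      by metis
    (* Distinct even exponents in one orbit share a representative, so c has multiplicities. *)
    define c where "c = Poly_Mapping.single \<rho> 1
        + (\<Sum>\<alpha>\<in>T \<inter> even_expos. Poly_Mapping.single (rep \<alpha>) (1::real))"
    (* The origin is an even exponent: if it belongs to T, adding it to the hull changes nothing. *)
    have "real_vec \<rho> \<in> convex hull (real_vec ` (T \<inter> even_expos))"
    proof (cases "0 \<in> T")
      case True
      then have "T \<inter> even_expos \<union> {0} = T \<inter> even_expos"
        by (auto simp: even_expos_def)
      then show ?thesis
        using adm(1) \<open>\<rho> \<in> R\<close> False by (auto simp: admissible_def)
    next
      case 0: False
      then show ?thesis
        using adm(2) \<open>\<rho> \<in> R\<close> False by (auto simp: origin_compatible_def)
    qed
    then have "sonc_poly n (sym_support n T) (sym_avg n (Poly_Mapping.single \<rho> 1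
        + (\<Sum>\<alpha>\<in>T \<inter> even_expos. Poly_Mapping.single \<alpha> 1)))"
      using T False \<open>\<rho> \<in> R\<close> by (intro sonc_poly_sym_avg[of T n] sonc_poly_ag) (auto simp: U intro!: ag_poly_hull)
    also have "sym_avg n (Poly_Mapping.single \<rho> 1
        + (\<Sum>\<alpha>\<in>T \<inter> even_expos. Poly_Mapping.single \<alpha> 1))
      = monom_mean n \<rho> + (\<Sum>\<alpha>\<in>T \<inter> even_expos. monom_mean n (rep \<alpha>))"
      unfolding sym_avg_add sym_avg_sum using T \<open>\<rho> \<in> R\<close> rep
      by (intro arg_cong2[of _ _ _ _ "(+)"] sum.cong refl)
         (use sym_avg_single monom_mean_cong in \<open>metis Int_iff subsetD\<close>)+
    also have "\<dots> = sym_poly monom_mean n R c"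
      unfolding c_def sym_poly_add sym_poly_sum using R \<open>\<rho> \<in> R\<close> rep
      by (intro arg_cong2[of _ _ _ _ "(+)"] sum.cong refl) (auto simp: sym_poly_single)
    finally have "sonc_poly n (sym_support n T) (sym_poly monom_mean n R c)" .
    moreover have "Poly_Mapping.keys c \<subseteq> R"
    proof -
      have "Poly_Mapping.lookup c \<alpha> = 0" if "\<alpha> \<notin> R" for \<alpha>
        using that rep \<open>\<rho> \<in> R\<close>
        by (auto simp: c_def lookup_add lookup_sum lookup_single when_def intro!: sum.neutral)
      then show ?thesis by (auto simp: in_keys_iff)
    qed
    ultimately have "c \<in> span ?C"
      by (auto simp: cone_sonc_def intro!: span_base)
    moreover have "(\<Sum>\<alpha>\<in>T \<inter> even_expos. Poly_Mapping.single (rep \<alpha>) 1) \<in> span ?C"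
      using rep orbit_even_iff by (intro span_sum span_base even) blast+
    ultimately show ?thesis
      using span_diff[of c ?C] by (fastforce simp: c_def)
  qed
qed

lemma cone_dim_sonc_mean:
  assumes "admissible n T R" "origin_compatible T R" "n \<le> k"
  shows "cone_dim (cone_sonc monom_mean k T R) = card R"
proof -
  have T: "finite T" "T \<subseteq> expos n" "R \<subseteq> T"
    using assms by (auto simp: admissible_def orbit_reps_def)
  have mono: "cone_sonc monom_mean n T R \<subseteq> cone_sonc monom_mean k T R"
    using T assms(3) by (intro cone_sonc_mean_mono)
  show ?thesis
  proof (rule cone_dim_full)
    show "finite R" using T finite_subset by blast
    show "Poly_Mapping.keys c \<subseteq> R" if "c \<in> cone_sonc monom_mean k T R" for c
      using that by (simp add: cone_sonc_def)
    show "Poly_Mapping.single \<rho> 1 \<in> span (cone_sonc monom_mean k T R)" if "\<rho> \<in> R" for \<rho>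
      using span_cone_sonc_mean[OF assms(1,2) that] span_mono[OF mono] by blast
  qed
qed

lemma limit_cone_sonc_mean:
  assumes "finite T" "T \<subseteq> expos n" "R \<subseteq> T"
  shows "limit_cone_sonc monom_mean n T R = cone_sonc monom_mean n T R"
  unfolding limit_cone_sonc_def using cone_sonc_mean_mono[OF assms] by blast

section \<open>The supports of the quadratic forms\<close>

lemma orbit_eq_inv: "orbit k \<alpha> = (\<lambda>\<sigma>. perm_expo (inv \<sigma>) \<alpha>) ` {\<sigma>. \<sigma> permutes {..<k}}"
proof -
  have "inv ` {\<sigma>. \<sigma> permutes {..<k}} = {\<sigma>. \<sigma> permutes {..<k}}"
    using image_inverse_permutations[of "{..<k}"] by (auto simp: image_def)
  then have "orbit k \<alpha> = (\<lambda>\<pi>. perm_expo \<pi> \<alpha>) ` inv ` {\<sigma>. \<sigma> permutes {..<k}}"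
    by (simp only: orbit_eq)
  then show ?thesis
    by (simp only: image_image)
qed

text \<open>
  Finitely supported maps on an additive monoid carry a convolution ring structure.  By default the
  simplifier rewrites \<open>Poly_Mapping.single 0 2\<close> to the numeral of that ring, which hides the
  exponent vector.
\<close>

declare single_numeral [simp del] single_one [simp del]

definition square_expo :: expo where
  "square_expo = Poly_Mapping.single 0 2"

definition mixed_expo :: expo where
  "mixed_expo = Poly_Mapping.single 0 1 + Poly_Mapping.single 1 1"

lemma square_expo_even: "square_expo \<in> even_expos"
  by (auto simp: even_expos_def square_expo_def lookup_single when_def)

lemma mixed_not_even: "i \<noteq> j \<Longrightarrow> Poly_Mapping.single i 1 + Poly_Mapping.single j 1 \<notin> even_expos"
  by (auto simp: even_expos_def lookup_add lookup_single when_def intro!: exI[of _ i])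

lemma mixed_expo_not_even: "mixed_expo \<notin> even_expos"
  unfolding mixed_expo_def by (rule mixed_not_even) simp

lemma square_neq_mixed: "square_expo \<noteq> mixed_expo"
  using square_expo_even mixed_expo_not_even by auto

lemma orbit_square:
  assumes "0 < k"
  shows "orbit k square_expo = (\<lambda>i. Poly_Mapping.single i 2) ` {..<k}"
proof (intro equalityI subsetI)
  fix \<beta> assume "\<beta> \<in> orbit k square_expo"
  then obtain \<sigma> where \<sigma>: "\<sigma> permutes {..<k}" "\<beta> = perm_expo (inv \<sigma>) square_expo"
    by (auto simp: orbit_eq_inv)
  then have "\<beta> = Poly_Mapping.single (\<sigma> 0) 2" "\<sigma> 0 < k"
    using assms permutes_in_image[OF \<sigma>(1), of 0]
    by (auto simp: square_expo_def perm_expo_single permutes_bij)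
  then show "\<beta> \<in> (\<lambda>i. Poly_Mapping.single i 2) ` {..<k}" by blast
next
  fix \<beta> assume "\<beta> \<in> (\<lambda>i. Poly_Mapping.single i (2::nat)) ` {..<k}"
  then obtain i where i: "i < k" "\<beta> = Poly_Mapping.single i 2" by auto
  have \<sigma>: "Transposition.transpose 0 i permutes {..<k}"
    using assms i by (intro permutes_swap_id) auto
  then have "perm_expo (inv (Transposition.transpose 0 i)) square_expo = \<beta>"
    unfolding square_expo_def by (subst perm_expo_single) (auto simp: permutes_bij i)
  then show "\<beta> \<in> orbit k square_expo"
    unfolding orbit_eq_inv using \<sigma> by blast
qed

text \<open>
  Ordering the two indices makes the parametrization injective, so that the orbit sum becomes a
  double sum.
\<close>

lemma orbit_mixed:
  assumes "2 \<le> k"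
  shows "orbit k mixed_expo
    = (\<lambda>(i, j). Poly_Mapping.single i 1 + Poly_Mapping.single j 1) ` (SIGMA i:{..<k}. {..<i})"
    (is "_ = ?f ` ?S")
proof -
  have move: "perm_expo (inv \<sigma>) mixed_expo = ?f (\<sigma> 0, \<sigma> 1)" if "\<sigma> permutes {..<k}" for \<sigma>
    using that permutes_bij[OF that]
    by (simp add: mixed_expo_def perm_expo_add perm_expo_single bij_is_inj bij_imp_bij_inv)
  show ?thesis
  proof (intro equalityI subsetI)
    fix \<beta> assume "\<beta> \<in> orbit k mixed_expo"
    then obtain \<sigma> where \<sigma>: "\<sigma> permutes {..<k}" "\<beta> = ?f (\<sigma> 0, \<sigma> 1)"
      using move by (auto simp: orbit_eq_inv)
    have "\<sigma> 0 < k" "\<sigma> 1 < k" "\<sigma> 0 \<noteq> \<sigma> 1"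
      using assms permutes_in_image[OF \<sigma>(1)] permutes_inj[OF \<sigma>(1)] by (auto simp: inj_eq)
    moreover have "?f (\<sigma> 0, \<sigma> 1) = ?f (\<sigma> 1, \<sigma> 0)"
      by (simp add: add.commute)
    ultimately show "\<beta> \<in> ?f ` ?S"
      using \<sigma>(2) by (cases "\<sigma> 1 < \<sigma> 0") (blast, force)
  next
    fix \<beta> assume "\<beta> \<in> ?f ` ?S"
    then obtain i j where ij: "i < k" "j < i" "\<beta> = ?f (i, j)" by auto
    (* Move 0 to i first; this takes 1 to some l, different from i, and then l is swapped with j. *)
    define l where "l = Transposition.transpose 0 i 1"
    define \<sigma> where "\<sigma> = Transposition.transpose l j \<circ> Transposition.transpose 0 i"
    have l: "l < k" "l \<noteq> i"
      using ij assms by (auto simp: l_def Transposition.transpose_def)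
    have \<sigma>: "\<sigma> permutes {..<k}"
      unfolding \<sigma>_def using ij l by (intro permutes_compose permutes_swap_id) auto
    have "\<sigma> 0 = i"
      using l ij by (simp add: \<sigma>_def)
    moreover have "\<sigma> 1 = j"
      unfolding \<sigma>_def o_apply by (fold l_def) simp
    ultimately have "perm_expo (inv \<sigma>) mixed_expo = \<beta>"
      using move[OF \<sigma>] ij by simp
    then show "\<beta> \<in> orbit k mixed_expo"
      unfolding orbit_eq_inv using \<sigma> by blast
  qed
qed

section \<open>A mixed coefficient cannot survive in the SONC limit\<close>

lemma lin_ext_monom_sym_square:
  assumes "0 < k"
  shows "lin_ext w (monom_sym k square_expo) = (\<Sum>i<k. w (Poly_Mapping.single i 2))"
proof -
  have "inj_on (\<lambda>i. Poly_Mapping.single i (2::nat)) {..<k}"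
    by (auto simp: inj_on_def poly_mapping_eq_iff fun_eq_iff lookup_single when_def split: if_splits)
  then show ?thesis
    by (simp add: monom_sym_def lin_ext_simps orbit_square[OF assms] sum.reindex)
qed

lemma lin_ext_monom_sym_mixed:
  assumes "2 \<le> k"
  shows "lin_ext w (monom_sym k mixed_expo)
    = (\<Sum>i<k. \<Sum>j<i. w (Poly_Mapping.single i 1 + Poly_Mapping.single j 1))"
proof -
  let ?f = "\<lambda>(i, j). Poly_Mapping.single i (1::nat) + Poly_Mapping.single j 1"
  have "inj_on ?f (SIGMA i:{..<k}. {..<i})"
  proof (rule inj_onI, clarsimp)
    fix i j i' j' :: nat
    assume "j < i" "j' < i'" and eq: "Poly_Mapping.single i (Suc 0) + Poly_Mapping.single j (Suc 0)
      = Poly_Mapping.single i' (Suc 0) + Poly_Mapping.single j' (Suc 0)"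
    have "l \<in> {i, j} \<longleftrightarrow> l \<in> {i', j'}" for l
      using arg_cong[OF eq, of "\<lambda>p. Poly_Mapping.lookup p l \<noteq> 0"]
      by (auto simp: lookup_add lookup_single when_def split: if_splits)
    then have "{i, j} = {i', j'}" by blast
    then show "i = i' \<and> j = j'"
      using \<open>j < i\<close> \<open>j' < i'\<close> by (auto simp: doubleton_eq_iff)
  qed
  then show ?thesis
    unfolding monom_sym_def orbit_mixed[OF assms]
    by (simp add: lin_ext_simps sum.reindex sum.Sigma case_prod_unfold)
qed

lemma lin_ext_example:
  assumes "2 \<le> k"
  shows "lin_ext w (sym_poly monom_sym k {square_expo, mixed_expo} c)
    = Poly_Mapping.lookup c square_expo * (\<Sum>i<k. w (Poly_Mapping.single i 2))
      + Poly_Mapping.lookup c mixed_expo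
        * (\<Sum>i<k. \<Sum>j<i. w (Poly_Mapping.single i 1 + Poly_Mapping.single j 1))"
  using assms square_neq_mixed
  by (simp add: sym_poly_def lin_ext_simps lin_ext_monom_sym_square lin_ext_monom_sym_mixed)

lemma square_of_sum:
  fixes x :: "nat \<Rightarrow> real"
  shows "(\<Sum>i<k. x i)\<^sup>2 = (\<Sum>i<k. (x i)\<^sup>2) + 2 * (\<Sum>i<k. \<Sum>j<i. x i * x j)"
  by (induction k) (simp_all add: power2_sum sum_distrib_left algebra_simps)

lemma sonc_poly_functional_nonneg:
  assumes "sonc_poly k U f" "\<And>g. ag_poly k U g \<Longrightarrow> 0 \<le> lin_ext w g"
  shows "0 \<le> lin_ext w f"
proof -
  obtain gs where "\<forall>g\<in>set gs. ag_poly k U g" "f = sum_list gs"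
    using assms(1) unfolding sonc_poly_def by blast
  then show ?thesis
    using assms(2) by (auto simp: lin_ext_sum_list intro!: sum_list_nonneg)
qed

lemma abs_monomial_le_1:
  assumes "\<And>i. \<bar>x i\<bar> \<le> 1"
  shows "\<bar>monomial x \<alpha>\<bar> \<le> 1"
  unfolding abs_monomial unfolding monomial_def
  using assms by (intro prod_le_1) (auto intro: power_le_one)

text \<open>
  The functional adds the coefficients of even exponents and subtracts those of odd ones.  On an
  AG polynomial it is at least the value at a suitable point of the cube \<open>[-1, 1]\<^sup>k\<close>: even
  monomials are at most one there, odd ones other than \<open>\<beta>\<close> do not occur, and the point is chosen
  so that \<open>x\<^sup>\<beta>\<close> has the value prescribed by the sign.
\<close>

lemma ag_poly_sign_functional_nonneg:
  assumes k: "2 \<le> k" and ag: "ag_poly k (sym_support k {square_expo, mixed_expo}) g"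
  shows "0 \<le> lin_ext (\<lambda>\<alpha>. if \<alpha> \<in> even_expos then 1 else - 1) g" (is "0 \<le> lin_ext ?w g")
proof -
  let ?U = "sym_support k {square_expo, mixed_expo}"
  have fin: "finite ?U" by (rule finite_sym_support) simp
  obtain \<beta> where g: "nonneg_poly k g" "Poly_Mapping.keys g \<subseteq> ?U" and "\<beta> \<in> ?U"
    and \<beta>: "\<forall>\<alpha>\<in>?U - {\<beta>}. 0 \<le> Poly_Mapping.lookup g \<alpha> \<and>
      (\<alpha> \<notin> even_expos \<longrightarrow> Poly_Mapping.lookup g \<alpha> = 0)"
    by (rule ag_polyE[OF fin ag], rule that)
  have "\<exists>x\<in>points k. (\<forall>i. \<bar>x i\<bar> \<le> 1) \<and> monomial x \<beta> = ?w \<beta>"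
  proof (cases "\<beta> \<in> even_expos")
    case True
    have "square_expo \<in> expos k" "mixed_expo \<in> expos k"
      using k by (auto simp: square_expo_def mixed_expo_def expos_def in_keys_iff lookup_add
          lookup_single when_def split: if_splits)
    then have "?U \<subseteq> expos k" by (intro sym_support_subset_expos) simp
    then show ?thesis
      using True \<open>\<beta> \<in> ?U\<close>
      by (intro bexI[of _ "indicator {..<k}"]) (auto simp: monomial_ones points_def indicator_def)
  next
    case False
    then have "\<beta> \<in> orbit k mixed_expo"
      using \<open>\<beta> \<in> ?U\<close> orbit_even_iff[of \<beta> k square_expo] square_expo_even by (auto simp: sym_support_def)
    then obtain i j where "i < k" "j < i" "\<beta> = Poly_Mapping.single i 1 + Poly_Mapping.single j 1"
      unfolding orbit_mixed[OF k] by auto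
    then show ?thesis
      using False
      (* the point e_i - e_j, at which the monomial x_i x_j is -1 *)
      by (intro bexI[of _ "\<lambda>l. if l = i then 1 else if l = j then - 1 else 0"])
         (auto simp: monomial_add monomial_single points_def)
  qed
  then obtain x where x: "x \<in> points k" "\<And>i. \<bar>x i\<bar> \<le> 1" "monomial x \<beta> = ?w \<beta>" by blast
  have "0 \<le> poly_eval x g"
    using g(1) x(1) by (auto simp: nonneg_poly_def)
  also have "\<dots> \<le> lin_ext ?w g"
    unfolding poly_eval_eq_lin_ext lin_ext_def
  proof (rule sum_mono)
    fix \<alpha> assume \<alpha>: "\<alpha> \<in> Poly_Mapping.keys g"
    show "Poly_Mapping.lookup g \<alpha> * monomial x \<alpha> \<le> Poly_Mapping.lookup g \<alpha> * ?w \<alpha>"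
    proof (cases "\<alpha> = \<beta>")
      case True
      then show ?thesis using x(3) by simp
    next
      case False
      then have "\<alpha> \<in> ?U - {\<beta>}" "Poly_Mapping.lookup g \<alpha> \<noteq> 0"
        using \<alpha> g(2) by (auto simp: in_keys_iff)
      then have "0 \<le> Poly_Mapping.lookup g \<alpha>" "\<alpha> \<in> even_expos"
        using \<beta> by blast+
      then show ?thesis
        using abs_monomial_le_1[of x \<alpha>, OF x(2)] by (intro mult_left_mono) auto
    qed
  qed
  finally show ?thesis .
qed

text \<open>
  The sign functional gives \<open>0 \<le> p k - q s\<close> and evaluation at the all-ones point gives
  \<open>0 \<le> p k + q s\<close>, where \<open>s = k (k - 1) / 2\<close> is the number of pairs.  Thus \<open>\<bar>q\<bar> (k - 1) \<le> 2 p\<close>, which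
  fails for large \<open>k\<close> unless \<open>q = 0\<close>.
\<close>

lemma sonc_mixed_coefficient_zero:
  assumes "\<And>k. 2 \<le> k \<Longrightarrow> sonc_poly k (sym_support k {square_expo, mixed_expo})
    (sym_poly monom_sym k {square_expo, mixed_expo} c)"
  shows "Poly_Mapping.lookup c mixed_expo = 0"
proof (rule ccontr)
  define p where "p = Poly_Mapping.lookup c square_expo"
  define q where "q = Poly_Mapping.lookup c mixed_expo"
  assume "Poly_Mapping.lookup c mixed_expo \<noteq> 0"
  then have q: "0 < \<bar>q\<bar>" by (simp add: q_def)
  obtain m :: nat where m: "2 * p / \<bar>q\<bar> < real m"
    using reals_Archimedean2 by blast
  (* k must be at least 2, and k - 1 = m + 1 exceeds the bound 2 p / |q| *)
  define k where "k = m + 2"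
  have k: "2 \<le> k" by (simp add: k_def)
  let ?f = "sym_poly monom_sym k {square_expo, mixed_expo} c"
  define s :: real where "s = (\<Sum>i<k. real i)"
  have "0 \<le> lin_ext (\<lambda>\<alpha>. if \<alpha> \<in> even_expos then 1 else - 1) ?f"
    using assms[OF k] ag_poly_sign_functional_nonneg[OF k] by (rule sonc_poly_functional_nonneg)
  moreover have "Poly_Mapping.single i 2 \<in> even_expos" for i
    by (auto simp: even_expos_def lookup_single when_def)
  ultimately have 1: "0 \<le> p * k - q * s"
    using mixed_not_even by (simp add: lin_ext_example[OF k] p_def q_def s_def sum_negf)
  have "0 \<le> lin_ext (monomial (indicator {..<k})) ?f"
    using assms[OF k] by (rule sonc_poly_functional_nonneg)
      (auto simp: ag_poly_def nonneg_poly_def points_def indicator_def poly_eval_eq_lin_ext)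
  then have 2: "0 \<le> p * k + q * s"
    by (simp add: lin_ext_example[OF k] p_def q_def s_def monomial_add monomial_single indicator_def)
  have "s = real k * (real m + 1) / 2"
  proof -
    have "(\<Sum>i<l. real i) = real l * (real l - 1) / 2" for l
      by (induction l) (simp_all add: field_simps)
    then show ?thesis by (simp only: s_def) (simp add: k_def algebra_simps)
  qed
  moreover have "\<bar>q\<bar> * s \<le> p * k"
    using 1 2 by (simp add: abs_if)
  moreover have "real k * (\<bar>q\<bar> * (real m + 1) / 2) = \<bar>q\<bar> * (real k * (real m + 1) / 2)"
    by simp
  ultimately have "real k * (\<bar>q\<bar> * (real m + 1) / 2) \<le> real k * p"
    by (simp only: mult.commute[of p])
  then have "\<bar>q\<bar> * (real m + 1) / 2 \<le> p"
    using k by (subst (asm) mult_le_cancel_left_pos) auto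
  moreover have "2 * p < \<bar>q\<bar> * real m"
    using m q by (simp add: field_simps)
  ultimately show False
    using q by (simp add: algebra_simps)
qed

section \<open>The dimension drop for quadratic forms\<close>

lemma sym_support_sym_support:
  assumes "k \<le> l"
  shows "sym_support l (sym_support k T) = sym_support l T"
proof (intro equalityI subsetI)
  fix \<gamma> assume "\<gamma> \<in> sym_support l (sym_support k T)"
  then obtain \<alpha> \<beta> where "\<alpha> \<in> T" "\<beta> \<in> orbit k \<alpha>" "\<gamma> \<in> orbit l \<beta>"
    by (auto simp: sym_support_def)
  then have "\<gamma> \<in> orbit l \<alpha>"
    using orbit_trans[OF subsetD[OF orbit_mono[OF assms]]] by blast
  then show "\<gamma> \<in> sym_support l T"
    using \<open>\<alpha> \<in> T\<close> by (auto simp: sym_support_def)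
next
  fix \<gamma> assume "\<gamma> \<in> sym_support l T"
  then show "\<gamma> \<in> sym_support l (sym_support k T)"
    using orbit_refl[of _ k] unfolding sym_support_def by blast
qed

definition example_support :: "expo set" where
  "example_support = sym_support 2 {square_expo, mixed_expo}"

text \<open>
  The exponent of \<open>x\<^sub>0 x\<^sub>1\<close> is the midpoint of those of \<open>x\<^sub>0\<^sup>2\<close> and \<open>x\<^sub>1\<^sup>2\<close>.
\<close>

lemma real_vec_mixed_in_hull:
  "real_vec mixed_expo \<in> convex hull (real_vec ` (example_support \<inter> even_expos))"
proof -
  have "Poly_Mapping.single i 2 \<in> example_support \<inter> even_expos" if "i < 2" for i
    using that orbit_square[of 2] by (auto simp: example_support_def sym_support_def
        even_expos_def lookup_single when_def)
  then have "real_vec (Poly_Mapping.single i 2)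
      \<in> convex hull (real_vec ` (example_support \<inter> even_expos))" if "i < 2" for i
    using that by (intro hull_inc imageI)
  from convexD[OF convex_convex_hull this[of 0] this[of 1], of "1/2" "1/2"]
  have "(1/2) *\<^sub>R real_vec (Poly_Mapping.single 0 2) + (1/2) *\<^sub>R real_vec (Poly_Mapping.single 1 2)
      \<in> convex hull (real_vec ` (example_support \<inter> even_expos))"
    by simp
  moreover have "real_vec mixed_expo
      = (1/2) *\<^sub>R real_vec (Poly_Mapping.single 0 2) + (1/2) *\<^sub>R real_vec (Poly_Mapping.single 1 2)"
    by (rule poly_mapping_eqI) (auto simp: mixed_expo_def real_vec_def map.rep_eq lookup_add lookup_scaleR
        lookup_single when_def)
  ultimately show ?thesis by simp
qed

lemma example_admissible:
  "admissible 2 example_support {square_expo, mixed_expo}"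
  "origin_compatible example_support {square_expo, mixed_expo}"
proof -
  let ?R = "{square_expo, mixed_expo}"
  have expos: "?R \<subseteq> expos 2"
    by (auto simp: square_expo_def mixed_expo_def expos_def in_keys_iff lookup_add
          lookup_single when_def split: if_splits)
  have "orbit_reps 2 example_support ?R"
    unfolding orbit_reps_def
  proof (intro conjI ballI ex_ex1I)
    show "?R \<subseteq> example_support"
      using orbit_refl by (auto simp: example_support_def sym_support_def)
    fix \<alpha> assume "\<alpha> \<in> example_support"
    then show "\<exists>\<rho>. \<rho> \<in> ?R \<and> \<rho> \<in> orbit 2 \<alpha>"
      using orbit_sym by (auto simp: example_support_def sym_support_def)
    fix \<rho> \<sigma> assume "\<rho> \<in> ?R \<and> \<rho> \<in> orbit 2 \<alpha>" "\<sigma> \<in> ?R \<and> \<sigma> \<in> orbit 2 \<alpha>"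
    then show "\<rho> = \<sigma>"
      using orbit_even_iff[of _ 2 \<alpha>] square_expo_even mixed_expo_not_even by auto
  qed
  moreover have "real_vec mixed_expo \<in> convex hull (real_vec ` (example_support \<inter> even_expos \<union> {0}))"
    by (rule subsetD[OF hull_mono[OF image_mono[OF Un_upper1]] real_vec_mixed_in_hull])
  moreover have "sym_invariant 2 example_support"
    using orbit_cong unfolding sym_invariant_def example_support_def sym_support_def by blast
  moreover have "example_support \<noteq> {}"
    using orbit_refl by (auto simp: example_support_def sym_support_def)
  ultimately show "admissible 2 example_support ?R"
    using square_expo_even sym_support_subset_expos[OF expos] finite_sym_support[of ?R 2]
    by (auto simp: admissible_def simp flip: example_support_def)
  show "origin_compatible example_support ?R"
    using square_expo_even real_vec_mixed_in_hull by (auto simp: origin_compatible_def)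
qed

lemma example_sonc_dim:
  "cone_dim (limit_cone_sonc monom_sym 2 example_support {square_expo, mixed_expo}) \<le> 1"
proof -
  let ?R = "{square_expo, mixed_expo}"
  have "c \<in> span {Poly_Mapping.single square_expo 1}"
    if "c \<in> limit_cone_sonc monom_sym 2 example_support ?R" for c
  proof -
    have cone: "c \<in> cone_sonc monom_sym k example_support ?R" if "2 \<le> k" for k
      using that \<open>c \<in> limit_cone_sonc _ _ _ _\<close> unfolding limit_cone_sonc_def by blast
    have c: "Poly_Mapping.keys c \<subseteq> ?R"
      using cone[of 2] by (simp add: cone_sonc_def)
    have "sonc_poly k (sym_support k ?R) (sym_poly monom_sym k ?R c)" if "2 \<le> k" for k
      using cone[OF that] unfolding cone_sonc_def example_support_def sym_support_sym_support[OF that]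
      by simp
    then have "Poly_Mapping.lookup c mixed_expo = 0"
      by (intro sonc_mixed_coefficient_zero)
    then have "c = Poly_Mapping.lookup c square_expo *\<^sub>R Poly_Mapping.single square_expo 1"
      using poly_mapping_sum_singles[OF _ c] square_neq_mixed by (simp add: scaleR_single)
    then show ?thesis
      by (metis insertI1 span_base span_scale)
  qed
  then have "limit_cone_sonc monom_sym 2 example_support ?R \<subseteq> span {Poly_Mapping.single square_expo 1}"
    by blast
  from dim_le_card[OF this] show ?thesis
    by (simp add: cone_dim_def)
qed

lemma example_nonneg_dim:
  "cone_dim (limit_cone_nonneg monom_sym 2 {square_expo, mixed_expo}) = 2"
proof -
  let ?R = "{square_expo, mixed_expo}" and ?C = "limit_cone_nonneg monom_sym 2 {square_expo, mixed_expo}"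
  let ?a = "Poly_Mapping.single square_expo (1::real)" and ?b = "Poly_Mapping.single mixed_expo (1::real)"
  have coeff: "Poly_Mapping.lookup ?a square_expo = 1" "Poly_Mapping.lookup ?a mixed_expo = 0"
      "Poly_Mapping.lookup ?b square_expo = 0" "Poly_Mapping.lookup ?b mixed_expo = 1"
    using square_neq_mixed by (auto simp: lookup_single when_def)
  have a: "?a \<in> ?C"
    by (auto simp: limit_cone_nonneg_def cone_nonneg_def nonneg_poly_def poly_eval_eq_lin_ext
        lin_ext_example coeff monomial_single intro!: sum_nonneg)
  (* Coefficients 1 and 2 give the square of the sum of the variables. *)
  have "?a + 2 *\<^sub>R ?b \<in> ?C"
  proof -
    have "0 \<le> poly_eval x (sym_poly monom_sym k ?R (?a + 2 *\<^sub>R ?b))" if "2 \<le> k" for x k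
    proof -
      have "poly_eval x (sym_poly monom_sym k ?R (?a + 2 *\<^sub>R ?b)) = (\<Sum>i<k. x i)\<^sup>2"
        using that by (simp add: poly_eval_eq_lin_ext lin_ext_example lookup_add lookup_scaleR coeff
            monomial_add monomial_single square_of_sum)
      then show ?thesis by simp
    qed
    moreover have "Poly_Mapping.keys (?a + 2 *\<^sub>R ?b) \<subseteq> ?R"
      using keys_add[of ?a "2 *\<^sub>R ?b"] by (auto simp: scaleR_single)
    ultimately show ?thesis
      by (auto simp: limit_cone_nonneg_def cone_nonneg_def nonneg_poly_def)
  qed
  then have "(1/2) *\<^sub>R ((?a + 2 *\<^sub>R ?b) - ?a) \<in> span ?C"
    using a by (intro span_scale span_diff span_base)
  then have "?b \<in> span ?C" by simp
  then have "cone_dim ?C = card ?R"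
    using a by (intro cone_dim_full)
      (auto simp: limit_cone_nonneg_def cone_nonneg_def intro: span_base)
  then show ?thesis using square_neq_mixed by simp
qed

theorem theorem5p14:
  shows
    "(\<forall>n T R. admissible n T R \<longrightarrow>
        (\<forall>k\<ge>n. cone_sonc monom_mean k T R \<subseteq> cone_sonc monom_mean (k + 1) T R) \<and>
        (origin_compatible T R \<longrightarrow>
           (\<forall>k\<ge>n. cone_dim (cone_sonc monom_mean k T R) = card R) \<and>
           cone_dim (limit_cone_sonc monom_mean n T R) = card R)) \<and>
     (\<exists>n T R. admissible n T R \<and> origin_compatible T R \<and>
        cone_dim (limit_cone_sonc monom_sym n T R) < cone_dim (limit_cone_nonneg monom_sym n R))"
proof (intro conjI allI impI)
  fix n T R assume adm: "admissible n T R"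
  then have T: "finite T" "T \<subseteq> expos n" "R \<subseteq> T"
    by (auto simp: admissible_def orbit_reps_def)
  show "cone_sonc monom_mean k T R \<subseteq> cone_sonc monom_mean (k + 1) T R" if "n \<le> k" for k
    using T expos_mono[OF that] by (intro cone_sonc_mean_mono) auto
  assume "origin_compatible T R"
  note dim = cone_dim_sonc_mean[OF adm this]
  show "cone_dim (cone_sonc monom_mean k T R) = card R" if "n \<le> k" for k
    using that by (rule dim)
  show "cone_dim (limit_cone_sonc monom_mean n T R) = card R"
    unfolding limit_cone_sonc_mean[OF T] by (rule dim) simp
next
  show "\<exists>n T R. admissible n T R \<and> origin_compatible T R \<and>
      cone_dim (limit_cone_sonc monom_sym n T R) < cone_dim (limit_cone_nonneg monom_sym n R)"
    using example_admissible example_sonc_dim example_nonneg_dim by force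
qed
end
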